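(* Let $\mathcal H$ and $\mathcal G$ be additive Krull-Schmidt categories. Let $S:\mathcal H\to\mathcal G$ and $T:\mathcal G\to\mathcal H$ be functors such that $(S,T)$ is an adjoint pair giving a normal subgroup situation $TS=\bigoplus_{i\in I}E_i$, and such that $E_{i_0}=\mathrm{id}_{\mathcal H}$ for some $i_0\in I$. Suppose that for any $i\in I$ there is a self-equivalence $\widehat E_i$ of $\mathcal G$ with $SE_i=\widehat E_iS$ and $T\widehat E_i=E_iT$. Then for any indecomposable object $W$ of $\mathcal H$ such that $E_jW\simeq W$ if and only if $j=i_0$, the object $S(W)$ is indecomposable as well.
   Context: An adjoint pair $(S,T)$ of functors $S:\mathcal H\to\mathcal G$ (left adjoint), $T:\mathcal G\to\mathcal H$ (right adjoint) gives a normal subgroup situation if $TS=\bigoplus_{i\in I}E_i$ for self-equivalences $E_i$ ($i\in I$) of $\mathcal H$. *)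

theory Defs
  imports "HOL-Algebra.Ring"
begin

section \<open>Categories\<close>

record ('o, 'm) cat =
  Obj :: "'o set"
  Arr :: "'m set"
  Dom :: "'m \<Rightarrow> 'o"
  Cod :: "'m \<Rightarrow> 'o"
  Idt :: "'o \<Rightarrow> 'm"
  Comp :: "'m \<Rightarrow> 'm \<Rightarrow> 'm"  (infixr \<open>\<cdot>\<index>\<close> 75)

definition Hom :: "('o, 'm, 'z) cat_scheme \<Rightarrow> 'o \<Rightarrow> 'o \<Rightarrow> 'm set" where
  "Hom C x y = {f \<in> Arr C. Dom C f = x \<and> Cod C f = y}"

(* g \<cdot> f is meaningful only if Cod f = Dom g; nothing is assumed about its value otherwise. *)
locale category =
  fixes C (structure)
  assumes dom_Obj: "f \<in> Arr C \<Longrightarrow> Dom C f \<in> Obj C"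
    and cod_Obj: "f \<in> Arr C \<Longrightarrow> Cod C f \<in> Obj C"
    and Idt_Hom: "x \<in> Obj C \<Longrightarrow> Idt C x \<in> Hom C x x"
    and Comp_Hom: "\<lbrakk>f \<in> Hom C x y; g \<in> Hom C y z\<rbrakk> \<Longrightarrow> g \<cdot> f \<in> Hom C x z"
    and Comp_assoc:
      "\<lbrakk>f \<in> Hom C w x; g \<in> Hom C x y; h \<in> Hom C y z\<rbrakk> \<Longrightarrow> (h \<cdot> g) \<cdot> f = h \<cdot> (g \<cdot> f)"
    and Comp_Idt: "f \<in> Hom C x y \<Longrightarrow> f \<cdot> Idt C x = f"
    and Idt_Comp: "f \<in> Hom C x y \<Longrightarrow> Idt C y \<cdot> f = f"

definition is_iso :: "('o, 'm, 'z) cat_scheme \<Rightarrow> 'o \<Rightarrow> 'o \<Rightarrow> 'm \<Rightarrow> bool" where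
  "is_iso C x y f \<longleftrightarrow> f \<in> Hom C x y \<and>
    (\<exists>g \<in> Hom C y x. g \<cdot>\<^bsub>C\<^esub> f = Idt C x \<and> f \<cdot>\<^bsub>C\<^esub> g = Idt C y)"

definition isomorphic_obj :: "('o, 'm, 'z) cat_scheme \<Rightarrow> 'o \<Rightarrow> 'o \<Rightarrow> bool" where
  "isomorphic_obj C x y \<longleftrightarrow> (\<exists>f. is_iso C x y f)"

definition zero_obj :: "('o, 'm, 'z) cat_scheme \<Rightarrow> 'o \<Rightarrow> bool" where
  "zero_obj C z \<longleftrightarrow> z \<in> Obj C \<and>
    (\<forall>x \<in> Obj C. (\<exists>!f. f \<in> Hom C x z) \<and> (\<exists>!f. f \<in> Hom C z x))"

(* P with structure maps \<iota> i : X i \<rightarrow> P is a direct sum (coproduct) of the family (X i), i \<in> I. The index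
   set may be infinite; for finite families in an additive category coproducts are biproducts. *)
definition direct_sum ::
  "('o, 'm, 'z) cat_scheme \<Rightarrow> 'i set \<Rightarrow> ('i \<Rightarrow> 'o) \<Rightarrow> 'o \<Rightarrow> ('i \<Rightarrow> 'm) \<Rightarrow> bool" where
  "direct_sum C I X P \<iota> \<longleftrightarrow> P \<in> Obj C \<and> (\<forall>i \<in> I. X i \<in> Obj C \<and> \<iota> i \<in> Hom C (X i) P) \<and>
    (\<forall>Y \<in> Obj C. \<forall>f. (\<forall>i \<in> I. f i \<in> Hom C (X i) Y) \<longrightarrow>
      (\<exists>!u. u \<in> Hom C P Y \<and> (\<forall>i \<in> I. u \<cdot>\<^bsub>C\<^esub> \<iota> i = f i)))"


section \<open>Additive Krull-Schmidt categories\<close>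

record ('o, 'm) preadd_cat = "('o, 'm) cat" +
  HAdd :: "'m \<Rightarrow> 'm \<Rightarrow> 'm"
  HZero :: "'o \<Rightarrow> 'o \<Rightarrow> 'm"

definition hom_group :: "('o, 'm, 'z) preadd_cat_scheme \<Rightarrow> 'o \<Rightarrow> 'o \<Rightarrow> 'm monoid" where
  "hom_group C x y = \<lparr>carrier = Hom C x y, mult = HAdd C, one = HZero C x y\<rparr>"

locale preadditive_category = category C for C (structure) +
  assumes hom_group: "\<lbrakk>x \<in> Obj C; y \<in> Obj C\<rbrakk> \<Longrightarrow> comm_group (hom_group C x y)"
    and Comp_HAdd: "\<lbrakk>f \<in> Hom C x y; g \<in> Hom C y z; g' \<in> Hom C y z\<rbrakk> \<Longrightarrow>
      HAdd C g g' \<cdot> f = HAdd C (g \<cdot> f) (g' \<cdot> f)"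
    and HAdd_Comp: "\<lbrakk>f \<in> Hom C x y; f' \<in> Hom C x y; g \<in> Hom C y z\<rbrakk> \<Longrightarrow>
      g \<cdot> HAdd C f f' = HAdd C (g \<cdot> f) (g \<cdot> f')"

definition biproduct ::
  "('o, 'm, 'z) preadd_cat_scheme \<Rightarrow> 'o \<Rightarrow> 'o \<Rightarrow> 'o \<Rightarrow> 'm \<Rightarrow> 'm \<Rightarrow> 'm \<Rightarrow> 'm \<Rightarrow> bool" where
  "biproduct C x y s i\<^sub>1 i\<^sub>2 p\<^sub>1 p\<^sub>2 \<longleftrightarrow> x \<in> Obj C \<and> y \<in> Obj C \<and> s \<in> Obj C \<and>
    i\<^sub>1 \<in> Hom C x s \<and> i\<^sub>2 \<in> Hom C y s \<and> p\<^sub>1 \<in> Hom C s x \<and> p\<^sub>2 \<in> Hom C s y \<and>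
    p\<^sub>1 \<cdot>\<^bsub>C\<^esub> i\<^sub>1 = Idt C x \<and> p\<^sub>2 \<cdot>\<^bsub>C\<^esub> i\<^sub>2 = Idt C y \<and>
    p\<^sub>2 \<cdot>\<^bsub>C\<^esub> i\<^sub>1 = HZero C x y \<and> p\<^sub>1 \<cdot>\<^bsub>C\<^esub> i\<^sub>2 = HZero C y x \<and>
    HAdd C (i\<^sub>1 \<cdot>\<^bsub>C\<^esub> p\<^sub>1) (i\<^sub>2 \<cdot>\<^bsub>C\<^esub> p\<^sub>2) = Idt C s"

locale additive_category = preadditive_category C for C (structure) +
  assumes ex_zero_obj: "\<exists>z. zero_obj C z"
    and ex_biproduct: "\<lbrakk>x \<in> Obj C; y \<in> Obj C\<rbrakk> \<Longrightarrow> \<exists>s i\<^sub>1 i\<^sub>2 p\<^sub>1 p\<^sub>2. biproduct C x y s i\<^sub>1 i\<^sub>2 p\<^sub>1 p\<^sub>2"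

definition indecomposable_obj :: "('o, 'm, 'z) preadd_cat_scheme \<Rightarrow> 'o \<Rightarrow> bool" where
  "indecomposable_obj C x \<longleftrightarrow> x \<in> Obj C \<and> \<not> zero_obj C x \<and>
    (\<forall>y z i\<^sub>1 i\<^sub>2 p\<^sub>1 p\<^sub>2. biproduct C y z x i\<^sub>1 i\<^sub>2 p\<^sub>1 p\<^sub>2 \<longrightarrow> zero_obj C y \<or> zero_obj C z)"

definition End_ring :: "('o, 'm, 'z) preadd_cat_scheme \<Rightarrow> 'o \<Rightarrow> 'm ring" where
  "End_ring C x = \<lparr>carrier = Hom C x x, mult = Comp C, one = Idt C x,
    zero = HZero C x x, add = HAdd C\<rparr>"

(* Not necessarily commutative: the ring is nonzero and its non-units are closed under addition. *)
definition local_ring :: "('a, 'z) ring_scheme \<Rightarrow> bool" where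
  "local_ring R \<longleftrightarrow> ring R \<and> \<one>\<^bsub>R\<^esub> \<noteq> \<zero>\<^bsub>R\<^esub> \<and>
    (\<forall>a \<in> carrier R - Units R. \<forall>b \<in> carrier R - Units R. a \<oplus>\<^bsub>R\<^esub> b \<notin> Units R)"

locale additive_krull_schmidt_category = additive_category C for C (structure) +
  assumes krull_schmidt: "x \<in> Obj C \<Longrightarrow>
    \<exists>(n::nat) X \<iota>. direct_sum C {..<n} X x \<iota> \<and> (\<forall>k<n. local_ring (End_ring C (X k)))"


section \<open>Functors\<close>

(* Functors are not required to be additive: adjoint functors between additive categories,
   and in particular equivalences, automatically are. *)
record ('o1, 'm1, 'o2, 'm2) fctr =
  ob :: "'o1 \<Rightarrow> 'o2"
  ar :: "'m1 \<Rightarrow> 'm2"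

definition is_functor ::
  "('o1, 'm1, 'y) cat_scheme \<Rightarrow> ('o2, 'm2, 'z) cat_scheme \<Rightarrow> ('o1, 'm1, 'o2, 'm2) fctr \<Rightarrow> bool" where
  "is_functor C D F \<longleftrightarrow>
    (\<forall>x \<in> Obj C. ob F x \<in> Obj D) \<and>
    (\<forall>x \<in> Obj C. \<forall>y \<in> Obj C. \<forall>f \<in> Hom C x y. ar F f \<in> Hom D (ob F x) (ob F y)) \<and>
    (\<forall>x \<in> Obj C. ar F (Idt C x) = Idt D (ob F x)) \<and>
    (\<forall>x \<in> Obj C. \<forall>y \<in> Obj C. \<forall>z \<in> Obj C. \<forall>f \<in> Hom C x y. \<forall>g \<in> Hom C y z.
      ar F (g \<cdot>\<^bsub>C\<^esub> f) = ar F g \<cdot>\<^bsub>D\<^esub> ar F f)"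

definition id_functor :: "('o, 'm, 'o, 'm) fctr" where
  "id_functor = \<lparr>ob = (\<lambda>x. x), ar = (\<lambda>f. f)\<rparr>"

definition comp_functor ::
  "('o2, 'm2, 'o3, 'm3) fctr \<Rightarrow> ('o1, 'm1, 'o2, 'm2) fctr \<Rightarrow> ('o1, 'm1, 'o3, 'm3) fctr"
  (infixr \<open>\<circ>\<^sub>F\<close> 75) where
  "G \<circ>\<^sub>F F = \<lparr>ob = (\<lambda>x. ob G (ob F x)), ar = (\<lambda>f. ar G (ar F f))\<rparr>"

definition nat_trans ::
  "('o1, 'm1, 'y) cat_scheme \<Rightarrow> ('o2, 'm2, 'z) cat_scheme \<Rightarrow>
   ('o1, 'm1, 'o2, 'm2) fctr \<Rightarrow> ('o1, 'm1, 'o2, 'm2) fctr \<Rightarrow> ('o1 \<Rightarrow> 'm2) \<Rightarrow> bool" where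
  "nat_trans C D F G \<tau> \<longleftrightarrow>
    (\<forall>x \<in> Obj C. \<tau> x \<in> Hom D (ob F x) (ob G x)) \<and>
    (\<forall>x \<in> Obj C. \<forall>y \<in> Obj C. \<forall>f \<in> Hom C x y. ar G f \<cdot>\<^bsub>D\<^esub> \<tau> x = \<tau> y \<cdot>\<^bsub>D\<^esub> ar F f)"

definition nat_isomorphic ::
  "('o1, 'm1, 'y) cat_scheme \<Rightarrow> ('o2, 'm2, 'z) cat_scheme \<Rightarrow>
   ('o1, 'm1, 'o2, 'm2) fctr \<Rightarrow> ('o1, 'm1, 'o2, 'm2) fctr \<Rightarrow> bool" where
  "nat_isomorphic C D F G \<longleftrightarrow>
    (\<exists>\<tau>. nat_trans C D F G \<tau> \<and> (\<forall>x \<in> Obj C. is_iso D (ob F x) (ob G x) (\<tau> x)))"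

definition self_equivalence :: "('o, 'm, 'z) cat_scheme \<Rightarrow> ('o, 'm, 'o, 'm) fctr \<Rightarrow> bool" where
  "self_equivalence C E \<longleftrightarrow> is_functor C C E \<and>
    (\<exists>E'. is_functor C C E' \<and>
      nat_isomorphic C C (E' \<circ>\<^sub>F E) id_functor \<and> nat_isomorphic C C (E \<circ>\<^sub>F E') id_functor)"

(* S is left adjoint to T: bijections \<phi> x y : Hom (S x) y \<rightarrow> Hom x (T y), natural in x and y. *)
definition adjoint_pair ::
  "('o1, 'm1, 'y) cat_scheme \<Rightarrow> ('o2, 'm2, 'z) cat_scheme \<Rightarrow>
   ('o1, 'm1, 'o2, 'm2) fctr \<Rightarrow> ('o2, 'm2, 'o1, 'm1) fctr \<Rightarrow> bool" where
  "adjoint_pair H G S T \<longleftrightarrow> is_functor H G S \<and> is_functor G H T \<and>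
    (\<exists>\<phi>. (\<forall>x \<in> Obj H. \<forall>y \<in> Obj G. bij_betw (\<phi> x y) (Hom G (ob S x) y) (Hom H x (ob T y))) \<and>
      (\<forall>x \<in> Obj H. \<forall>x' \<in> Obj H. \<forall>y \<in> Obj G. \<forall>y' \<in> Obj G.
        \<forall>f \<in> Hom H x' x. \<forall>g \<in> Hom G y y'. \<forall>h \<in> Hom G (ob S x) y.
          \<phi> x' y' (g \<cdot>\<^bsub>G\<^esub> h \<cdot>\<^bsub>G\<^esub> ar S f) = ar T g \<cdot>\<^bsub>H\<^esub> \<phi> x y h \<cdot>\<^bsub>H\<^esub> f))"

(* F is the (objectwise) direct sum of the functors E i, i \<in> I, with natural structure maps. *)
definition functor_direct_sum ::
  "('o1, 'm1, 'y) cat_scheme \<Rightarrow> ('o2, 'm2, 'z) cat_scheme \<Rightarrow>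
   'i set \<Rightarrow> ('i \<Rightarrow> ('o1, 'm1, 'o2, 'm2) fctr) \<Rightarrow> ('o1, 'm1, 'o2, 'm2) fctr \<Rightarrow> bool" where
  "functor_direct_sum C D I E F \<longleftrightarrow>
    (\<exists>\<iota>. (\<forall>i \<in> I. nat_trans C D (E i) F (\<iota> i)) \<and>
      (\<forall>x \<in> Obj C. direct_sum D I (\<lambda>i. ob (E i) x) (ob F x) (\<lambda>i. \<iota> i x)))"

definition normal_subgroup_situation ::
  "('o1, 'm1, 'y) cat_scheme \<Rightarrow> ('o2, 'm2, 'z) cat_scheme \<Rightarrow>
   ('o1, 'm1, 'o2, 'm2) fctr \<Rightarrow> ('o2, 'm2, 'o1, 'm1) fctr \<Rightarrow>
   'i set \<Rightarrow> ('i \<Rightarrow> ('o1, 'm1, 'o1, 'm1) fctr) \<Rightarrow> bool" where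
  "normal_subgroup_situation H G S T I E \<longleftrightarrow> adjoint_pair H G S T \<and>
    (\<forall>i \<in> I. self_equivalence H (E i)) \<and> functor_direct_sum H H I E (T \<circ>\<^sub>F S)"

end

theory Submission
  imports Defs
begin

text \<open>
  Write \<open>h \<mapsto> \<phi> h\<close> for the adjunction bijection \<open>Hom(S W, S W) \<cong> Hom(W, T S W)\<close>, and recall that
  \<open>T S W\<close> is the direct sum of the objects \<open>E\<^sub>i W\<close>. Since \<open>W\<close> is indecomposable in a Krull-Schmidt
  category, its endomorphism ring is local, and so are the endomorphism rings of the \<open>E\<^sub>i W\<close>. The
  idea is that \<open>End(S W)\<close> maps to the residue division ring \<open>End(W)/rad\<close> by taking the component of
  \<open>\<phi> h\<close> in \<open>E\<^bsub>i0\<^esub> W \<cong> W\<close>; the other components lie in the radical, because \<open>E\<^sub>i W\<close> is not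
  isomorphic to \<open>W\<close>, and this makes the map multiplicative up to the invertible factor that the
  adjunction unit contributes. No nonzero split idempotent is sent to zero. As complementary
  idempotents have product zero and a division ring has no zero divisors, one of the two must vanish.

  The proof phrases this without the radical: a morphism out of a local object fails to be
  radical exactly if it is a split monomorphism. The steps that carry the argument are the following.

  \<^item> The index set is finite (\<open>finite_index\<close>). Indeed \<open>T S W\<close> is a sum of \<open>n\<close> local objects for some
    \<open>n\<close>, and by an exchange argument (\<open>card_orthogonal_local_retracts_le\<close>) it cannot have more than
    \<open>n\<close> orthogonal local retracts. Hence the identity of \<open>T S W\<close> is a finite sum of the projections
    to the \<open>E\<^sub>i W\<close>, and an isomorphism of a local object that factors through \<open>T S W\<close> is already an
    isomorphism on one of these components (\<open>local_iso_through_resolution\<close>).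

  \<^item> If \<open>e = i p\<close> is an idempotent of \<open>S W\<close> that splits through a nonzero object, then \<open>\<phi> e\<close> is a
    split monomorphism (\<open>retract_transpose_split_mono\<close>). Otherwise \<open>T e\<close>, which factors through
    \<open>T S (\<phi> e)\<close>, would be radical on each summand \<open>E\<^sub>i W\<close> because it factors there through
    \<open>E\<^sub>i (\<phi> e)\<close> (\<open>\<phi>_split_mono\<close>); but \<open>T e\<close> is an idempotent that is the identity on some local
    object.

  \<^item> For complementary idempotents \<open>e\<close> and \<open>f\<close> of \<open>S W\<close>, the composite \<open>T e \<cdot> \<phi> f = \<phi> (e f)\<close> is zero. If
    both are nonzero, then \<open>T e\<close> is a split monomorphism on \<open>E\<^bsub>i0\<^esub> W\<close> and \<open>\<phi> f\<close> has an invertible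
    component there, so that the other components of \<open>\<phi> f\<close> would have to compensate for an
    isomorphism, which radical morphisms cannot do (\<open>indecomposable_image\<close>).

  Functors are not additive by definition, so the facts about self-equivalences are derived from
  composition alone: zero is the absorbing endomorphism, and locality of an object is detected by
  its idempotents.
\<close>

section \<open>Composition, isomorphisms and split monomorphisms\<close>

context category
begin

lemma Hom_Dom_Obj: "f \<in> Hom C x y \<Longrightarrow> x \<in> Obj C"
  and Hom_Cod_Obj: "f \<in> Hom C x y \<Longrightarrow> y \<in> Obj C"
  using dom_Obj cod_Obj by (auto simp: Hom_def)

text \<open>
  In terms of domains and codomains the category laws become conditional rewrite rules without
  extra variables in their premises. With membership in \<open>Hom\<close> unfolded, they let the simplifier
  normalise composites.
\<close>

lemma Idt_simps [simp]:
  assumes "x \<in> Obj C"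
  shows "Idt C x \<in> Arr C" "Dom C (Idt C x) = x" "Cod C (Idt C x) = x"
  using Idt_Hom[OF assms] by (auto simp: Hom_def)

lemma Comp_simps [simp]:
  assumes "f \<in> Arr C" "g \<in> Arr C" "Cod C f = Dom C g"
  shows "g \<cdot> f \<in> Arr C" "Dom C (g \<cdot> f) = Dom C f" "Cod C (g \<cdot> f) = Cod C g"
  using Comp_Hom[of f "Dom C f" "Dom C g" g "Cod C g"] assms by (auto simp: Hom_def)

lemma Comp_assoc_simp [simp]:
  assumes "f \<in> Arr C" "g \<in> Arr C" "h \<in> Arr C" "Cod C f = Dom C g" "Cod C g = Dom C h"
  shows "(h \<cdot> g) \<cdot> f = h \<cdot> (g \<cdot> f)"
  using Comp_assoc[of f "Dom C f" "Dom C g" g "Dom C h" h "Cod C h"] assms by (auto simp: Hom_def)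

lemma Comp_Idt_simp [simp]: "f \<in> Arr C \<Longrightarrow> Dom C f = x \<Longrightarrow> f \<cdot> Idt C x = f"
  using Comp_Idt[of f x "Cod C f"] by (auto simp: Hom_def)

lemma Idt_Comp_simp [simp]: "f \<in> Arr C \<Longrightarrow> Cod C f = y \<Longrightarrow> Idt C y \<cdot> f = f"
  using Idt_Comp[of f "Dom C f" y] by (auto simp: Hom_def)

text \<open>The simplifier nests composites to the right, which hides a known composite \<open>g \<cdot> f\<close>.\<close>

lemma Comp_reassoc:
  assumes "g \<cdot> f = h" "f \<in> Hom C x y" "g \<in> Hom C y z" "k \<in> Hom C w x"
  shows "g \<cdot> (f \<cdot> k) = h \<cdot> k"
  using Comp_assoc[OF assms(4,2,3)] assms(1) by simp

end

text \<open>
  For a local object \<open>x\<close>, the morphisms out of \<open>x\<close> that are not split monomorphisms form the radical.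
  Unlike the radical itself, the notion depends on composition alone, which makes it transport
  along equivalences.
\<close>

definition split_mono :: "('o, 'm, 'z) cat_scheme \<Rightarrow> 'o \<Rightarrow> 'o \<Rightarrow> 'm \<Rightarrow> bool" where
  "split_mono C x y f \<longleftrightarrow> f \<in> Hom C x y \<and> (\<exists>g \<in> Hom C y x. g \<cdot>\<^bsub>C\<^esub> f = Idt C x)"

context category
begin

lemma is_iso_Hom: "is_iso C x y f \<Longrightarrow> f \<in> Hom C x y"
  by (simp add: is_iso_def)

lemma is_isoE:
  assumes "is_iso C x y f"
  obtains g where "g \<in> Hom C y x" "g \<cdot> f = Idt C x" "f \<cdot> g = Idt C y" "is_iso C y x g"
  using assms unfolding is_iso_def by blast

lemma is_iso_Comp:
  assumes "is_iso C x y f" "is_iso C y z g"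
  shows "is_iso C x z (g \<cdot> f)"
proof -
  obtain f' where f': "f' \<in> Hom C y x" "f' \<cdot> f = Idt C x" "f \<cdot> f' = Idt C y"
    using assms(1) by (rule is_isoE)
  obtain g' where g': "g' \<in> Hom C z y" "g' \<cdot> g = Idt C y" "g \<cdot> g' = Idt C z"
    using assms(2) by (rule is_isoE)
  note fg = is_iso_Hom[OF assms(1)] is_iso_Hom[OF assms(2)]
  have "(f' \<cdot> g') \<cdot> (g \<cdot> f) = Idt C x" "(g \<cdot> f) \<cdot> (f' \<cdot> g') = Idt C z"
    using fg f' g' Comp_reassoc[OF g'(2) fg(2) g'(1) fg(1)] Comp_reassoc[OF f'(3) f'(1) fg(1) g'(1)]
    by (auto simp: Hom_def)
  then show ?thesis
    unfolding is_iso_def using fg f' g' Comp_Hom by blast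
qed

lemma is_iso_cancel_right:
  assumes "is_iso C x y f" "g \<in> Hom C y z" "is_iso C x z (g \<cdot> f)"
  shows "is_iso C y z g"
proof -
  obtain f' where f': "f' \<in> Hom C y x" "f' \<cdot> f = Idt C x" "f \<cdot> f' = Idt C y" "is_iso C y x f'"
    using assms(1) by (rule is_isoE)
  have "(g \<cdot> f) \<cdot> f' = g"
    using f' assms(2) is_iso_Hom[OF assms(1)] by (auto simp: Hom_def)
  then show ?thesis
    using is_iso_Comp[OF f'(4) assms(3)] by simp
qed

lemma split_mono_Comp_left:
  assumes "split_mono C x z (g \<cdot> f)" "f \<in> Hom C x y" "g \<in> Hom C y z"
  shows "split_mono C x y f"
proof -
  obtain h where h: "h \<in> Hom C z x" "h \<cdot> (g \<cdot> f) = Idt C x"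
    using assms(1) unfolding split_mono_def by blast
  then have "(h \<cdot> g) \<cdot> f = Idt C x"
    using Comp_assoc[OF assms(2,3) h(1)] by simp
  then show ?thesis
    using assms(2) Comp_Hom[OF assms(3) h(1)] unfolding split_mono_def by blast
qed

lemma is_iso_imp_split_mono: "is_iso C x y f \<Longrightarrow> split_mono C x y f"
  by (auto simp: is_iso_def split_mono_def)

end

section \<open>Sums of morphisms\<close>

context preadditive_category
begin

lemma HAdd_Hom [intro]: "f \<in> Hom C x y \<Longrightarrow> g \<in> Hom C x y \<Longrightarrow> HAdd C f g \<in> Hom C x y"
proof -
  assume a: "f \<in> Hom C x y" "g \<in> Hom C x y"
  interpret comm_group "hom_group C x y"
    by (rule hom_group[OF Hom_Dom_Obj[OF a(1)] Hom_Cod_Obj[OF a(1)]])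
  show ?thesis using m_closed[of f g] a by (simp add: hom_group_def)
qed

lemma HZero_Hom [intro]: "x \<in> Obj C \<Longrightarrow> y \<in> Obj C \<Longrightarrow> HZero C x y \<in> Hom C x y"
proof -
  assume a: "x \<in> Obj C" "y \<in> Obj C"
  interpret comm_group "hom_group C x y"
    using hom_group a by blast
  show ?thesis using one_closed by (simp add: hom_group_def)
qed

lemma HAdd_simps [simp]:
  assumes "f \<in> Arr C" "g \<in> Arr C" "Dom C f = Dom C g" "Cod C f = Cod C g"
  shows "HAdd C f g \<in> Arr C" "Dom C (HAdd C f g) = Dom C g" "Cod C (HAdd C f g) = Cod C g"
  using HAdd_Hom[of f "Dom C g" "Cod C g" g] assms by (auto simp: Hom_def)

lemma HZero_simps [simp]:
  assumes "x \<in> Obj C" "y \<in> Obj C"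
  shows "HZero C x y \<in> Arr C" "Dom C (HZero C x y) = x" "Cod C (HZero C x y) = y"
  using HZero_Hom[OF assms] by (auto simp: Hom_def)

lemma HAdd_HZero:
  assumes "f \<in> Hom C x y"
  shows "HAdd C f (HZero C x y) = f" "HAdd C (HZero C x y) f = f"
proof -
  interpret comm_group "hom_group C x y"
    by (rule hom_group[OF Hom_Dom_Obj[OF assms(1)] Hom_Cod_Obj[OF assms(1)]])
  show "HAdd C f (HZero C x y) = f" "HAdd C (HZero C x y) f = f"
    using r_one[of f] l_one[of f] assms by (auto simp: hom_group_def)
qed

lemma HAdd_HZero_simp [simp]:
  assumes "f \<in> Arr C" "Dom C f = x" "Cod C f = y"
  shows "HAdd C f (HZero C x y) = f" "HAdd C (HZero C x y) f = f"
  using HAdd_HZero[of f x y] assms by (auto simp: Hom_def)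

lemma ex_difference:
  assumes "f \<in> Hom C x y" "h \<in> Hom C x y"
  shows "\<exists>g \<in> Hom C x y. HAdd C f g = h"
proof -
  interpret comm_group "hom_group C x y"
    by (rule hom_group[OF Hom_Dom_Obj[OF assms(1)] Hom_Cod_Obj[OF assms(1)]])
  let ?M = "hom_group C x y"
  have f: "f \<in> carrier ?M" and h: "h \<in> carrier ?M"
    using assms by (simp_all add: hom_group_def)
  have "f \<otimes>\<^bsub>?M\<^esub> (inv\<^bsub>?M\<^esub> f \<otimes>\<^bsub>?M\<^esub> h) = h"
    using f h by (simp add: m_assoc[symmetric])
  moreover have "inv\<^bsub>?M\<^esub> f \<otimes>\<^bsub>?M\<^esub> h \<in> carrier ?M"
    using f h by simp
  ultimately show ?thesis by (auto simp: hom_group_def)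
qed

text \<open>
  Subtraction is not among the given operations; cancellation and \<open>ex_difference\<close> replace it.
\<close>

lemma HAdd_left_cancel:
  assumes "f \<in> Hom C x y" "g \<in> Hom C x y" "h \<in> Hom C x y" "HAdd C f g = HAdd C f h"
  shows "g = h"
proof -
  interpret comm_group "hom_group C x y"
    by (rule hom_group[OF Hom_Dom_Obj[OF assms(1)] Hom_Cod_Obj[OF assms(1)]])
  show ?thesis using assms Units_l_cancel[of f g h] unfolding Units_eq by (simp add: hom_group_def)
qed

lemma HAdd_cancel:
  assumes "f \<in> Hom C x y" "g \<in> Hom C x y" "HAdd C f g = f"
  shows "g = HZero C x y"
  using HAdd_left_cancel[OF assms(1,2) HZero_Hom[OF Hom_Dom_Obj[OF assms(1)] Hom_Cod_Obj[OF assms(1)]]]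
    HAdd_HZero(1)[OF assms(1)] assms(3) by simp

lemma HAdd_commute:
  assumes "f \<in> Hom C x y" "g \<in> Hom C x y"
  shows "HAdd C f g = HAdd C g f"
proof -
  interpret comm_group "hom_group C x y"
    by (rule hom_group[OF Hom_Dom_Obj[OF assms(1)] Hom_Cod_Obj[OF assms(1)]])
  show ?thesis using assms m_comm[of f g] by (auto simp: hom_group_def)
qed

lemma HZero_Comp:
  assumes "f \<in> Hom C x y" "z \<in> Obj C"
  shows "HZero C y z \<cdot> f = HZero C x z"
proof -
  note y = Hom_Cod_Obj[OF assms(1)]
  have z: "HZero C y z \<in> Hom C y z" using y assms by blast
  have "HAdd C (HZero C y z \<cdot> f) (HZero C y z \<cdot> f) = HZero C y z \<cdot> f"
    using Comp_HAdd[OF assms(1) z z] HAdd_HZero(1)[OF z] by simp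
  then show ?thesis using HAdd_cancel Comp_Hom[OF assms(1) z] by blast
qed

lemma Comp_HZero:
  assumes "g \<in> Hom C y z" "x \<in> Obj C"
  shows "g \<cdot> HZero C x y = HZero C x z"
proof -
  note y = Hom_Dom_Obj[OF assms(1)]
  have z: "HZero C x y \<in> Hom C x y" using y assms by blast
  have "HAdd C (g \<cdot> HZero C x y) (g \<cdot> HZero C x y) = g \<cdot> HZero C x y"
    using HAdd_Comp[OF z z assms(1)] HAdd_HZero(1)[OF z] by simp
  then show ?thesis using HAdd_cancel Comp_Hom[OF z assms(1)] by blast
qed

lemma zero_Comp_simp [simp]:
  "f \<in> Arr C \<Longrightarrow> Cod C f = y \<Longrightarrow> z \<in> Obj C \<Longrightarrow> HZero C y z \<cdot> f = HZero C (Dom C f) z"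
  "g \<in> Arr C \<Longrightarrow> Dom C g = y \<Longrightarrow> x \<in> Obj C \<Longrightarrow> g \<cdot> HZero C x y = HZero C x (Cod C g)"
  using HZero_Comp[of f "Dom C f" y z] Comp_HZero[of g y "Cod C g" x] by (auto simp: Hom_def)

lemma HAdd_Comp_simp [simp]:
  assumes "f \<in> Arr C" "f' \<in> Arr C" "g \<in> Arr C" "Dom C f = Dom C f'" "Cod C f = Cod C f'" "Cod C f' = Dom C g"
  shows "g \<cdot> HAdd C f f' = HAdd C (g \<cdot> f) (g \<cdot> f')"
  using HAdd_Comp[of f "Dom C f'" "Dom C g" f' g "Cod C g"] assms by (auto simp: Hom_def)

lemma Comp_HAdd_simp [simp]:
  assumes "f \<in> Arr C" "g' \<in> Arr C" "g \<in> Arr C" "Dom C g = Dom C g'" "Cod C g = Cod C g'" "Cod C f = Dom C g'"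
  shows "HAdd C g g' \<cdot> f = HAdd C (g \<cdot> f) (g' \<cdot> f)"
  using Comp_HAdd[of f "Dom C f" "Dom C g'" g "Cod C g'" g'] assms by (auto simp: Hom_def)

lemma zero_obj_iff: "zero_obj C x \<longleftrightarrow> x \<in> Obj C \<and> Idt C x = HZero C x x"
proof (intro iffI conjI)
  assume z: "zero_obj C x"
  then show x: "x \<in> Obj C" by (simp add: zero_obj_def)
  then have "\<exists>!f. f \<in> Hom C x x" using z by (simp add: zero_obj_def)
  then show "Idt C x = HZero C x x" using Idt_Hom[OF x] HZero_Hom[OF x x] by blast
next
  assume a: "x \<in> Obj C \<and> Idt C x = HZero C x x"
  have "\<exists>!f. f \<in> Hom C y x" "\<exists>!f. f \<in> Hom C x y" if y: "y \<in> Obj C" for y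
  proof -
    have "f = HZero C y x" if "f \<in> Hom C y x" for f
      using that a Idt_Comp[OF that] HZero_Comp[OF that, of x] by simp
    then show "\<exists>!f. f \<in> Hom C y x" using HZero_Hom[of y x] y a by blast
    have "f = HZero C x y" if "f \<in> Hom C x y" for f
      using that a Comp_Idt[OF that] Comp_HZero[OF that, of x] by simp
    then show "\<exists>!f. f \<in> Hom C x y" using HZero_Hom[of x y] y a by blast
  qed
  then show "zero_obj C x" using a by (simp add: zero_obj_def)
qed

lemma nonzero_if_split_mono:
  assumes "split_mono C x y f" "Idt C x \<noteq> HZero C x x"
  shows "f \<noteq> HZero C x y"
  using assms Comp_HZero Hom_Dom_Obj unfolding split_mono_def by metis

lemma HZero_not_iso: "Idt C x \<noteq> HZero C x x \<Longrightarrow> \<not> is_iso C x y (HZero C x y)"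
  using nonzero_if_split_mono is_iso_imp_split_mono by blast

text \<open>
  The inverse is the negative \<open>n\<close> of the inverse \<open>w\<close> of \<open>u\<close>: both \<open>u \<cdot> w\<close> and \<open>v \<cdot> n\<close> are negatives of
  \<open>u \<cdot> n\<close>.
\<close>

lemma is_iso_negative:
  assumes u: "is_iso C x y u" and v: "v \<in> Hom C x y" and uv: "HAdd C u v = HZero C x y"
  shows "is_iso C x y v"
proof -
  obtain w where w: "w \<in> Hom C y x" "w \<cdot> u = Idt C x" "u \<cdot> w = Idt C y"
    using u by (rule is_isoE)
  note u = is_iso_Hom[OF u]
  note ob = Hom_Dom_Obj[OF u] Hom_Cod_Obj[OF u]
  obtain n where n: "n \<in> Hom C y x" "HAdd C w n = HZero C y x"
    using ex_difference[OF w(1) HZero_Hom[OF ob(2,1)]] by blast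
  have "HAdd C (u \<cdot> n) (v \<cdot> n) = HZero C y y"
    using Comp_HAdd[OF n(1) u v] uv HZero_Comp[OF n(1) ob(2)] by simp
  moreover have "HAdd C (u \<cdot> n) (u \<cdot> w) = HZero C y y"
    using HAdd_Comp[OF w(1) n(1) u] n(2) Comp_HZero[OF u ob(2)]
      HAdd_commute[OF Comp_Hom[OF n(1) u] Comp_Hom[OF w(1) u]] by simp
  ultimately have vn: "v \<cdot> n = Idt C y"
    using HAdd_left_cancel[OF Comp_Hom[OF n(1) u] Comp_Hom[OF n(1) v] Comp_Hom[OF w(1) u]] w(3) by simp
  have "HAdd C (n \<cdot> u) (n \<cdot> v) = HZero C x x"
    using HAdd_Comp[OF u v n(1)] uv Comp_HZero[OF n(1) ob(1)] by simp
  moreover have "HAdd C (n \<cdot> u) (w \<cdot> u) = HZero C x x"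
    using Comp_HAdd[OF u w(1) n(1)] n(2) HZero_Comp[OF u ob(1)]
      HAdd_commute[OF Comp_Hom[OF u n(1)] Comp_Hom[OF u w(1)]] by simp
  ultimately have nv: "n \<cdot> v = Idt C x"
    using HAdd_left_cancel[OF Comp_Hom[OF u n(1)] Comp_Hom[OF v n(1)] Comp_Hom[OF u w(1)]] w(2) by simp
  show ?thesis unfolding is_iso_def using v n(1) vn nv by blast
qed

end

section \<open>Local objects\<close>

text \<open>
  Locality of the endomorphism ring, with units written as isomorphisms so that objects rather than
  rings can be compared.
\<close>

definition local_obj :: "('o, 'm, 'z) preadd_cat_scheme \<Rightarrow> 'o \<Rightarrow> bool" where
  "local_obj C x \<longleftrightarrow> x \<in> Obj C \<and> Idt C x \<noteq> HZero C x x \<and>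
    (\<forall>a \<in> Hom C x x. \<forall>b \<in> Hom C x x. is_iso C x x (HAdd C a b) \<longrightarrow> is_iso C x x a \<or> is_iso C x x b)"

context preadditive_category
begin

lemma Units_End_ring: "Units (End_ring C x) = {f. is_iso C x x f}"
  by (auto simp: Units_def End_ring_def is_iso_def)

lemma local_obj_if_local_ring:
  assumes "local_ring (End_ring C x)" "x \<in> Obj C"
  shows "local_obj C x"
  using assms unfolding local_ring_def local_obj_def Units_End_ring
  by (auto simp: End_ring_def)

text \<open>
  With \<open>d\<close> the complement of \<open>e\<close>, one of the two is invertible, and \<open>e d = 0\<close> then forces \<open>d = 0\<close>
  or \<open>e = 0\<close>.
\<close>

lemma local_obj_idempotent:
  assumes "local_obj C x" "e \<in> Hom C x x" "e \<cdot> e = e"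
  shows "e = Idt C x \<or> e = HZero C x x"
proof -
  have x: "x \<in> Obj C" using assms by (simp add: local_obj_def)
  obtain d where d: "d \<in> Hom C x x" "HAdd C e d = Idt C x"
    using ex_difference[OF assms(2) Idt_Hom[OF x]] by blast
  have "e \<cdot> (HAdd C e d) = e" using d assms x by (simp add: Hom_def)
  then have "HAdd C e (e \<cdot> d) = e"
    using d(1) assms by (simp add: Hom_def)
  then have ed: "e \<cdot> d = HZero C x x"
    by (rule HAdd_cancel[OF assms(2) Comp_Hom[OF d(1) assms(2)]])
  have "is_iso C x x (HAdd C e d)"
    using d Idt_Hom[OF x] Comp_Idt[OF Idt_Hom[OF x]] unfolding is_iso_def d(2) by blast
  then consider "is_iso C x x e" | "is_iso C x x d"
    using assms d unfolding local_obj_def by blast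
  then show ?thesis
  proof cases
    case 1
    then obtain g where g: "g \<in> Hom C x x" "g \<cdot> e = Idt C x"
      by (rule is_isoE)
    then have "g \<cdot> (e \<cdot> e) = e"
      using Comp_reassoc[OF g(2) assms(2) g(1) assms(2)] Idt_Comp[OF assms(2)] by simp
    then show ?thesis using assms g by simp
  next
    case 2
    then obtain g where g: "g \<in> Hom C x x" "d \<cdot> g = Idt C x"
      by (rule is_isoE)
    then have "(e \<cdot> d) \<cdot> g = e"
      using Comp_assoc[OF g(1) d(1) assms(2)] Comp_Idt[OF assms(2)] by simp
    then show ?thesis using ed HZero_Comp[OF g(1) x] by simp
  qed
qed

text \<open>
  If \<open>g \<cdot> f\<close> is an identity, then \<open>f \<cdot> g\<close> is an idempotent of a local object; it is nonzero, hence an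
  identity.
\<close>

lemma split_mono_into_local_is_iso:
  assumes f: "split_mono C x y f" and x: "Idt C x \<noteq> HZero C x x" and y: "local_obj C y"
  shows "is_iso C x y f"
proof -
  obtain g where g: "g \<in> Hom C y x" "g \<cdot> f = Idt C x" and fH: "f \<in> Hom C x y"
    using f unfolding split_mono_def by blast
  have "(f \<cdot> g) \<cdot> (f \<cdot> g) = f \<cdot> g"
    using Comp_reassoc[OF g(2) fH g(1) g(1)] g fH by (simp add: Hom_def)
  then consider "f \<cdot> g = Idt C y" | "f \<cdot> g = HZero C y y"
    using local_obj_idempotent[OF y] Comp_Hom[OF g(1) fH] by blast
  then show ?thesis
  proof cases
    case 1
    then show ?thesis using g fH unfolding is_iso_def by blast
  next
    case 2
    have "f = (f \<cdot> g) \<cdot> f" using g fH by (simp add: Hom_def)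
    then have "f = HZero C x y" using 2 HZero_Comp[OF fH Hom_Cod_Obj[OF fH]] by simp
    then show ?thesis using nonzero_if_split_mono[OF f x] by simp
  qed
qed

text \<open>
  Conjugation by \<open>f\<close> is additive and reflects isomorphisms.
\<close>

lemma local_obj_iso:
  assumes y: "local_obj C y" and i: "is_iso C x y f"
  shows "local_obj C x"
proof -
  obtain g where g: "g \<in> Hom C y x" "g \<cdot> f = Idt C x" "f \<cdot> g = Idt C y" "is_iso C y x g"
    using i by (rule is_isoE)
  note f = is_iso_Hom[OF i]
  note ob = Hom_Dom_Obj[OF f] Hom_Cod_Obj[OF f]
  have "Idt C x \<noteq> HZero C x x"
  proof
    assume "Idt C x = HZero C x x"
    then have "f = HZero C x y" using Comp_Idt[OF f] Comp_HZero[OF f ob(1)] by simp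
    then have "Idt C y = HZero C y y" using g HZero_Comp[OF g(1), of y] ob by simp
    then show False using y by (simp add: local_obj_def)
  qed
  moreover have "is_iso C x x a \<or> is_iso C x x b"
    if a: "a \<in> Hom C x x" and b: "b \<in> Hom C x x" and ab: "is_iso C x x (HAdd C a b)" for a b
  proof -
    have conj: "is_iso C x x c" if c: "c \<in> Hom C x x" and "is_iso C y y (f \<cdot> c \<cdot> g)" for c
    proof -
      have "is_iso C x y (f \<cdot> c)"
        using is_iso_cancel_right[OF g(4), of "f \<cdot> c" y] that f g Comp_Hom[OF c f] by (simp add: Hom_def)
      then have "is_iso C x x (g \<cdot> (f \<cdot> c))" using is_iso_Comp g(4) by blast
      moreover have "g \<cdot> (f \<cdot> c) = c"
        using Comp_reassoc[OF g(2) f g(1) c] c by (simp add: Hom_def)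
      ultimately show ?thesis by simp
    qed
    have "is_iso C y y (f \<cdot> HAdd C a b \<cdot> g)"
      using is_iso_Comp[OF is_iso_Comp[OF g(4) ab] i] f g a b by (simp add: Hom_def)
    moreover have "f \<cdot> HAdd C a b \<cdot> g = HAdd C (f \<cdot> a \<cdot> g) (f \<cdot> b \<cdot> g)"
      using f g a b by (simp add: Hom_def)
    moreover have "f \<cdot> a \<cdot> g \<in> Hom C y y" "f \<cdot> b \<cdot> g \<in> Hom C y y"
      using f g a b by (simp_all add: Hom_def)
    ultimately have "is_iso C y y (f \<cdot> a \<cdot> g) \<or> is_iso C y y (f \<cdot> b \<cdot> g)"
      using y unfolding local_obj_def by auto
    then show ?thesis using conj a b by blast
  qed
  ultimately show ?thesis using ob unfolding local_obj_def by blast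
qed

end

section \<open>Direct sums\<close>

lemma direct_sum_Hom:
  assumes "direct_sum C I X P \<iota>"
  shows "P \<in> Obj C" "i \<in> I \<Longrightarrow> X i \<in> Obj C" "i \<in> I \<Longrightarrow> \<iota> i \<in> Hom C (X i) P"
  using assms unfolding direct_sum_def by auto

lemma direct_sum_universal:
  assumes "direct_sum C I X P \<iota>" "Y \<in> Obj C" "\<And>i. i \<in> I \<Longrightarrow> f i \<in> Hom C (X i) Y"
  shows "\<exists>!u. u \<in> Hom C P Y \<and> (\<forall>i \<in> I. u \<cdot>\<^bsub>C\<^esub> \<iota> i = f i)"
proof -
  have "\<forall>i \<in> I. f i \<in> Hom C (X i) Y" using assms(3) by simp
  then show ?thesis using assms(1,2) unfolding direct_sum_def by simp
qed

lemma direct_sum_ext: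
  assumes P: "direct_sum C I X P \<iota>" and C: "category C"
    and u: "u \<in> Hom C P Y" and v: "v \<in> Hom C P Y"
    and uv: "\<And>i. i \<in> I \<Longrightarrow> u \<cdot>\<^bsub>C\<^esub> \<iota> i = v \<cdot>\<^bsub>C\<^esub> \<iota> i"
  shows "u = v"
proof -
  interpret category C by (rule C)
  have "\<exists>!w. w \<in> Hom C P Y \<and> (\<forall>i \<in> I. w \<cdot>\<^bsub>C\<^esub> \<iota> i = v \<cdot>\<^bsub>C\<^esub> \<iota> i)"
    using direct_sum_universal[OF P Hom_Cod_Obj[OF v] Comp_Hom[OF direct_sum_Hom(3)[OF P] v]] .
  then show ?thesis using u v uv by blast
qed

text \<open>
  This says that the identity of \<open>P\<close> is a sum of morphisms \<open>\<iota> k \<cdot> \<pi> k\<close>, expressed as membership in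
  every additively closed set that contains zero and all of them. The formulation avoids summation
  over finite families in hom-groups and is an induction principle: typically \<open>M\<close> is the set of
  those \<open>m\<close> for which a composite with \<open>m\<close> in the middle is not invertible.
\<close>

definition resolution_of_identity ::
  "('o, 'm, 'z) preadd_cat_scheme \<Rightarrow> 'o \<Rightarrow> 'i set \<Rightarrow> ('i \<Rightarrow> 'o) \<Rightarrow> ('i \<Rightarrow> 'm) \<Rightarrow> ('i \<Rightarrow> 'm) \<Rightarrow> bool" where
  "resolution_of_identity C P K X \<iota> \<pi> \<longleftrightarrow> P \<in> Obj C \<and>
    (\<forall>k \<in> K. \<iota> k \<in> Hom C (X k) P \<and> \<pi> k \<in> Hom C P (X k)) \<and>
    (\<forall>M \<subseteq> Hom C P P. HZero C P P \<in> M \<longrightarrow> (\<forall>a \<in> M. \<forall>b \<in> M. HAdd C a b \<in> M) \<longrightarrow>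
      (\<forall>k \<in> K. \<iota> k \<cdot>\<^bsub>C\<^esub> \<pi> k \<in> M) \<longrightarrow> Idt C P \<in> M)"

context preadditive_category
begin

lemma direct_sum_projections:
  assumes P: "direct_sum C I X P \<iota>"
  obtains \<pi> where "\<And>i. i \<in> I \<Longrightarrow> \<pi> i \<in> Hom C P (X i)"
    "\<And>i. i \<in> I \<Longrightarrow> \<pi> i \<cdot> \<iota> i = Idt C (X i)"
    "\<And>i j. i \<in> I \<Longrightarrow> j \<in> I \<Longrightarrow> i \<noteq> j \<Longrightarrow> \<pi> i \<cdot> \<iota> j = HZero C (X j) (X i)"
proof -
  have "\<exists>p. p \<in> Hom C P (X i) \<and>
    (\<forall>j \<in> I. p \<cdot> \<iota> j = (if i = j then Idt C (X i) else HZero C (X j) (X i)))" if i: "i \<in> I" for i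
  proof -
    have "(if i = j then Idt C (X i) else HZero C (X j) (X i)) \<in> Hom C (X j) (X i)" if "j \<in> I" for j
      using direct_sum_Hom(2)[OF P] i that Idt_Hom by auto
    then show ?thesis
      using ex1_implies_ex[OF direct_sum_universal[OF P direct_sum_Hom(2)[OF P i]]] by simp
  qed
  then obtain \<pi> where "\<And>i. i \<in> I \<Longrightarrow> \<pi> i \<in> Hom C P (X i) \<and>
    (\<forall>j \<in> I. \<pi> i \<cdot> \<iota> j = (if i = j then Idt C (X i) else HZero C (X j) (X i)))"
    by metis
  then show ?thesis by (intro that[of \<pi>]) auto
qed

text \<open>
  The partial sums of the \<open>\<iota> k \<cdot> \<pi> k\<close> lie in \<open>M\<close>; a partial sum is recognised by its restriction to the
  summands, and the one that restricts to the identity on each summand is the identity.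
\<close>

lemma finite_direct_sum_resolution:
  assumes P: "direct_sum C I X P \<iota>" and fin: "finite I"
    and \<pi>: "\<And>i. i \<in> I \<Longrightarrow> \<pi> i \<in> Hom C P (X i)"
    "\<And>i. i \<in> I \<Longrightarrow> \<pi> i \<cdot> \<iota> i = Idt C (X i)"
    "\<And>i j. i \<in> I \<Longrightarrow> j \<in> I \<Longrightarrow> i \<noteq> j \<Longrightarrow> \<pi> i \<cdot> \<iota> j = HZero C (X j) (X i)"
  shows "resolution_of_identity C P I X \<iota> \<pi>"
  unfolding resolution_of_identity_def
proof (intro conjI ballI allI impI)
  note D = direct_sum_Hom[OF P]
  show "P \<in> Obj C" by (rule D(1))
  show "\<iota> k \<in> Hom C (X k) P" "\<pi> k \<in> Hom C P (X k)" if "k \<in> I" for k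
    using D \<pi> that by auto
  fix M
  assume M: "M \<subseteq> Hom C P P" "HZero C P P \<in> M" "\<forall>a \<in> M. \<forall>b \<in> M. HAdd C a b \<in> M"
    and gen: "\<forall>k \<in> I. \<iota> k \<cdot> \<pi> k \<in> M"
  have "\<exists>s \<in> M. (\<forall>l \<in> K. s \<cdot> \<iota> l = \<iota> l) \<and> (\<forall>l \<in> I - K. s \<cdot> \<iota> l = HZero C (X l) P)"
    if "finite K" "K \<subseteq> I" for K
    using that
  proof (induction K)
    case empty
    have "HZero C P P \<cdot> \<iota> l = HZero C (X l) P" if "l \<in> I" for l
      using HZero_Comp[OF D(3)[OF that] D(1)] .
    then show ?case using M(2) by auto
  next
    case (insert k K)
    then obtain s where s: "s \<in> M" "\<And>l. l \<in> K \<Longrightarrow> s \<cdot> \<iota> l = \<iota> l"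
      "\<And>l. l \<in> I - K \<Longrightarrow> s \<cdot> \<iota> l = HZero C (X l) P"
      by auto
    have k: "k \<in> I" "k \<notin> K" using insert by auto
    have sH: "s \<in> Hom C P P" using s M by auto
    note kH = D(3)[OF k(1)] \<pi>(1)[OF k(1)]
    let ?s = "HAdd C s (\<iota> k \<cdot> \<pi> k)"
    have expand: "?s \<cdot> \<iota> l = HAdd C (s \<cdot> \<iota> l) (\<iota> k \<cdot> (\<pi> k \<cdot> \<iota> l))" if "l \<in> I" for l
      using sH kH D(3)[OF that] by (simp add: Hom_def)
    have "?s \<cdot> \<iota> l = \<iota> l" if l: "l \<in> insert k K" for l
    proof (cases "l = k")
      case True
      then show ?thesis
        using expand[OF k(1)] s(3)[of k] k \<pi>(2)[OF k(1)] Comp_Idt[OF D(3)[OF k(1)]]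
          HAdd_HZero(2)[OF D(3)[OF k(1)]] by simp
    next
      case False
      then have lK: "l \<in> K" and lI: "l \<in> I" using l insert by auto
      show ?thesis
        using expand[OF lI] s(2)[OF lK] \<pi>(3)[OF k(1) lI] False
          Comp_HZero[OF kH(1) D(2)[OF lI]] HAdd_HZero(1)[OF D(3)[OF lI]] by simp
    qed
    moreover have "?s \<cdot> \<iota> l = HZero C (X l) P" if l: "l \<in> I - insert k K" for l
    proof -
      have lI: "l \<in> I" "k \<noteq> l" "l \<in> I - K" using l by auto
      show ?thesis
        using expand[OF lI(1)] s(3)[OF lI(3)] \<pi>(3)[OF k(1) lI(1) lI(2)]
          Comp_HZero[OF kH(1) D(2)[OF lI(1)]]
          HAdd_HZero(1)[OF HZero_Hom[OF D(2)[OF lI(1)] D(1)]] by simp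
    qed
    moreover have "?s \<in> M" using M s gen k by auto
    ultimately show ?case by blast
  qed
  from this[OF fin] obtain s where s: "s \<in> M" "\<And>l. l \<in> I \<Longrightarrow> s \<cdot> \<iota> l = \<iota> l" by auto
  have "s = Idt C P"
    using s M(1) Idt_Hom[OF D(1)] Idt_Comp[OF D(3)]
    by (intro direct_sum_ext[OF P category_axioms, of s P]) auto
  then show "Idt C P \<in> M" using s by simp
qed

text \<open>
  The isomorphism \<open>g \<cdot> f\<close> of \<open>Z\<close> is a sum of the endomorphisms \<open>g \<cdot> \<iota> k \<cdot> \<pi> k \<cdot> f\<close>, and non-isomorphisms of
  a local object are closed under addition.
\<close>

lemma local_iso_through_resolution:
  assumes res: "resolution_of_identity C P K X \<iota> \<pi>"
    and Z: "local_obj C Z" and f: "f \<in> Hom C Z P" and g: "g \<in> Hom C P Z"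
    and iso: "is_iso C Z Z (g \<cdot> f)"
  obtains k where "k \<in> K" "is_iso C Z Z (g \<cdot> \<iota> k \<cdot> \<pi> k \<cdot> f)"
proof -
  note R = res[unfolded resolution_of_identity_def]
  let ?M = "{m \<in> Hom C P P. \<not> is_iso C Z Z (g \<cdot> m \<cdot> f)}"
  have Z': "Z \<in> Obj C" "Idt C Z \<noteq> HZero C Z Z" using Z by (auto simp: local_obj_def)
  have "g \<cdot> HZero C P P \<cdot> f = HZero C Z Z"
    using f g Z' R by (simp add: Hom_def)
  then have 0: "HZero C P P \<in> ?M" using R HZero_Hom HZero_not_iso[OF Z'(2)] by simp
  have add: "HAdd C a b \<in> ?M" if a: "a \<in> ?M" and b: "b \<in> ?M" for a b
  proof -
    have "g \<cdot> HAdd C a b \<cdot> f = HAdd C (g \<cdot> a \<cdot> f) (g \<cdot> b \<cdot> f)"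
      using a b f g by (simp add: Hom_def)
    moreover have "g \<cdot> a \<cdot> f \<in> Hom C Z Z" "g \<cdot> b \<cdot> f \<in> Hom C Z Z"
      using a b f g by (simp_all add: Hom_def)
    ultimately show ?thesis using a b Z HAdd_Hom unfolding local_obj_def by auto
  qed
  have "Idt C P \<cdot> f = f" by (rule Idt_Comp[OF f])
  then have "Idt C P \<notin> ?M" using iso by auto
  then have "\<not> (\<forall>k \<in> K. \<iota> k \<cdot> \<pi> k \<in> ?M)"
    using R 0 add by (metis (no_types, lifting) mem_Collect_eq subsetI)
  then obtain k where k: "k \<in> K" "\<iota> k \<cdot> \<pi> k \<notin> ?M" by blast
  have "(\<iota> k \<cdot> \<pi> k) \<cdot> f = \<iota> k \<cdot> \<pi> k \<cdot> f" "\<iota> k \<cdot> \<pi> k \<in> Hom C P P"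
    using R k f by (auto simp: Hom_def)
  then show ?thesis using that k by auto
qed

lemma nonzero_resolution:
  assumes "resolution_of_identity C P K X \<iota> \<pi>" "Idt C P \<noteq> HZero C P P"
  obtains k where "k \<in> K" "\<iota> k \<cdot> \<pi> k \<noteq> HZero C P P"
proof -
  note R = assms(1)[unfolded resolution_of_identity_def]
  have "\<not> (\<forall>k \<in> K. \<iota> k \<cdot> \<pi> k \<in> {HZero C P P})"
    using R assms(2) HAdd_HZero(1)[OF HZero_Hom] HZero_Hom
    by (metis singletonD singletonI empty_subsetI insert_subset)
  then show ?thesis using that by auto
qed

text \<open>
  The complementary idempotent \<open>1 - i p\<close>.
\<close>

lemma complement_of_retract:
  assumes i: "i \<in> Hom C X P" and p: "p \<in> Hom C P X" and pi: "p \<cdot> i = Idt C X"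
  obtains q where "q \<in> Hom C P P" "HAdd C (i \<cdot> p) q = Idt C P"
    "p \<cdot> q = HZero C P X" "q \<cdot> i = HZero C X P"
proof -
  note ob = Hom_Dom_Obj[OF i] Hom_Cod_Obj[OF i]
  obtain q where q: "q \<in> Hom C P P" "HAdd C (i \<cdot> p) q = Idt C P"
    using ex_difference[OF Comp_Hom[OF p i] Idt_Hom[OF ob(2)]] by blast
  have "p \<cdot> HAdd C (i \<cdot> p) q = HAdd C (p \<cdot> i \<cdot> p) (p \<cdot> q)" "HAdd C (i \<cdot> p) q \<cdot> i = HAdd C (i \<cdot> p \<cdot> i) (q \<cdot> i)"
    using q(1) i p by (simp_all add: Hom_def)
  moreover have "p \<cdot> i \<cdot> p = p" using Comp_reassoc[OF pi i p p] Idt_Comp[OF p] by simp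
  moreover have "i \<cdot> p \<cdot> i = i" using pi Comp_Idt[OF i] by simp
  ultimately have "HAdd C p (p \<cdot> q) = p" "HAdd C i (q \<cdot> i) = i"
    using q Comp_Idt[OF p] Idt_Comp[OF i] by auto
  then show ?thesis
    using that q HAdd_cancel[OF p Comp_Hom[OF q(1) p]] HAdd_cancel[OF i Comp_Hom[OF i q(1)]] by blast
qed

text \<open>
  This is the exchange step of the Krull-Schmidt theorem, carried out as Gaussian elimination. The
  local retract \<open>A j\<close> of \<open>P\<close> is isomorphic through \<open>w k \<cdot> a j\<close> to some local object \<open>Z k\<close>. Projecting
  the other inclusions along \<open>a j\<close> onto the kernel of \<open>w k\<close> keeps them orthogonal retracts and clears
  their components at \<open>k\<close>. The set \<open>K\<close> contains the components that are not yet cleared, and its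
  cardinality is the induction variable.
\<close>

lemma card_orthogonal_local_retracts_le:
  fixes a :: "'j \<Rightarrow> 'b"
  assumes res: "resolution_of_identity C P K0 Z z w" and Z: "\<And>k. k \<in> K0 \<Longrightarrow> local_obj C (Z k)"
    and K: "finite K" "K \<subseteq> K0"
    and A: "\<And>j. j \<in> J \<Longrightarrow> local_obj C (A j)"
    and a: "\<And>j. j \<in> J \<Longrightarrow> a j \<in> Hom C (A j) P" and p: "\<And>j. j \<in> J \<Longrightarrow> p j \<in> Hom C P (A j)"
    and pa: "\<And>j. j \<in> J \<Longrightarrow> p j \<cdot> a j = Idt C (A j)"
    and orth: "\<And>i j. i \<in> J \<Longrightarrow> j \<in> J \<Longrightarrow> i \<noteq> j \<Longrightarrow> p i \<cdot> a j = HZero C (A j) (A i)"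
    and vanish: "\<And>k j. k \<in> K0 - K \<Longrightarrow> j \<in> J \<Longrightarrow> w k \<cdot> a j = HZero C (A j) (Z k)"
  shows "finite J \<and> card J \<le> card K"
  using K A a p pa orth vanish
proof (induction "card K" arbitrary: K J a)
  have wz: "z k \<in> Hom C (Z k) P" "w k \<in> Hom C P (Z k)" if "k \<in> K0" for k
    using res that unfolding resolution_of_identity_def by auto
  have hit: "\<exists>k \<in> K. is_iso C (A j) (A j) ((p j \<cdot> z k) \<cdot> (w k \<cdot> a j)) \<and> is_iso C (A j) (Z k) (w k \<cdot> a j)"
    if "j \<in> J" and J: "\<And>j. j \<in> J \<Longrightarrow> local_obj C (A j)" "\<And>j. j \<in> J \<Longrightarrow> a j \<in> Hom C (A j) P"
      "\<And>j. j \<in> J \<Longrightarrow> p j \<in> Hom C P (A j)" "\<And>j. j \<in> J \<Longrightarrow> p j \<cdot> a j = Idt C (A j)"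
      "\<And>k j. k \<in> K0 - K \<Longrightarrow> j \<in> J \<Longrightarrow> w k \<cdot> a j = HZero C (A j) (Z k)" for j J K and a :: "'j \<Rightarrow> 'b"
  proof -
    note j = J(1-4)[OF \<open>j \<in> J\<close>]
    have Aj: "A j \<in> Obj C" "Idt C (A j) \<noteq> HZero C (A j) (A j)" using j(1) by (auto simp: local_obj_def)
    have "is_iso C (A j) (A j) (p j \<cdot> a j)"
      using j(4) Idt_Hom[OF Aj(1)] Idt_Comp[OF Idt_Hom[OF Aj(1)]] by (auto simp: is_iso_def)
    then obtain k where k: "k \<in> K0" "is_iso C (A j) (A j) (p j \<cdot> z k \<cdot> w k \<cdot> a j)"
      using local_iso_through_resolution[OF res j(1,2,3)] by blast
    have wa: "w k \<cdot> a j \<in> Hom C (A j) (Z k)" and pz: "p j \<cdot> z k \<in> Hom C (Z k) (A j)"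
      using Comp_Hom j wz[OF k(1)] by blast+
    have eq: "p j \<cdot> z k \<cdot> w k \<cdot> a j = (p j \<cdot> z k) \<cdot> (w k \<cdot> a j)"
      using j wz[OF k(1)] by (simp add: Hom_def)
    then have sm: "split_mono C (A j) (Z k) (w k \<cdot> a j)"
      using split_mono_Comp_left[OF _ wa pz] is_iso_imp_split_mono k(2) by simp
    then have "k \<in> K"
      using nonzero_if_split_mono[OF sm Aj(2)] J(5)[of k j] k(1) \<open>j \<in> J\<close> by blast
    moreover have "is_iso C (A j) (Z k) (w k \<cdot> a j)"
      using split_mono_into_local_is_iso[OF sm Aj(2)] Z k(1) by blast
    ultimately show ?thesis using k(2) eq by auto
  qed
  {
    case 0
    then have "K = {}" by simp
    then have "J = {}" using hit[OF _ 0(4,5,6,7,9)] by blast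
    then show ?case by simp
  next
    case (Suc n)
    show ?case
    proof (cases "J = {}")
      case False
      then obtain j where j: "j \<in> J" by blast
      obtain k where k: "k \<in> K" "is_iso C (A j) (Z k) (w k \<cdot> a j)"
        using hit[OF j Suc.prems(3,4,5,6,8)] by blast
      have kK: "k \<in> K0" using k Suc.prems by blast
      note w = wz(2)[OF kK] and aj = Suc.prems(4)[OF j]
      obtain c where c: "c \<in> Hom C (Z k) (A j)" "c \<cdot> (w k \<cdot> a j) = Idt C (A j)" "(w k \<cdot> a j) \<cdot> c = Idt C (Z k)"
        using k(2) by (rule is_isoE)
      have cw: "c \<cdot> w k \<in> Hom C P (A j)" using Comp_Hom[OF w c(1)] .
      have "(c \<cdot> w k) \<cdot> a j = Idt C (A j)"
        using c w aj by (simp add: Hom_def)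
      \<comment> \<open>The projection with image the kernel of \<open>w k\<close> that kills \<open>a j\<close>.\<close>
      then obtain q where q: "q \<in> Hom C P P" "HAdd C (a j \<cdot> (c \<cdot> w k)) q = Idt C P"
        "(c \<cdot> w k) \<cdot> q = HZero C P (A j)" "q \<cdot> a j = HZero C (A j) P"
        using complement_of_retract[OF aj cw] by metis
      note Pob = Hom_Dom_Obj[OF q(1)]
      have wq: "w k \<cdot> q = HZero C P (Z k)"
      proof -
        have "w k \<cdot> q = ((w k \<cdot> a j) \<cdot> c) \<cdot> (w k \<cdot> q)"
          unfolding c(3) using w q(1) by (simp add: Hom_def)
        also have "\<dots> = (w k \<cdot> a j) \<cdot> ((c \<cdot> w k) \<cdot> q)"
          using w q(1) c(1) aj by (simp add: Hom_def)
        also have "\<dots> = HZero C P (Z k)"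
          unfolding q(3) using Comp_HZero[OF Comp_Hom[OF aj w] Pob] .
        finally show ?thesis .
      qed
      have pq: "p i \<cdot> q = p i" if i: "i \<in> J - {j}" for i
      proof -
        have pi: "p i \<in> Hom C P (A i)" using Suc.prems(5) i by blast
        have "p i \<cdot> a j = HZero C (A j) (A i)" using Suc.prems(7) i j by blast
        then have 0: "p i \<cdot> a j \<cdot> (c \<cdot> w k) = HZero C P (A i)"
          using Comp_assoc[OF cw aj pi] HZero_Comp[OF cw Hom_Cod_Obj[OF pi]] by simp
        have "p i = p i \<cdot> HAdd C (a j \<cdot> (c \<cdot> w k)) q" using q(2) Comp_Idt[OF pi] by simp
        also have "\<dots> = HAdd C (p i \<cdot> a j \<cdot> (c \<cdot> w k)) (p i \<cdot> q)"
          by (rule HAdd_Comp[OF Comp_Hom[OF cw aj] q(1) pi])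
        also have "\<dots> = p i \<cdot> q" unfolding 0 by (rule HAdd_HZero(2)[OF Comp_Hom[OF q(1) pi]])
        finally show ?thesis by simp
      qed
      have *: "finite (J - {j}) \<and> card (J - {j}) \<le> card (K - {k})"
      proof (rule Suc.hyps(1)[of _ _ "\<lambda>i. q \<cdot> a i"])
        show "n = card (K - {k})" using Suc.hyps(2) k(1) Suc.prems(1) by simp
        show "finite (K - {k})" "K - {k} \<subseteq> K0" using Suc.prems by auto
        fix i assume i: "i \<in> J - {j}"
        show "local_obj C (A i)" "p i \<in> Hom C P (A i)" using Suc.prems i by auto
        have ai: "a i \<in> Hom C (A i) P" using Suc.prems i by auto
        show "q \<cdot> a i \<in> Hom C (A i) P" using Comp_Hom[OF ai q(1)] .
        have pqa: "p l \<cdot> q \<cdot> a i = p l \<cdot> a i" if "l \<in> J - {j}" for l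
          using Comp_assoc[OF ai q(1), of "p l" "A l"] pq[OF that] Suc.prems(5)[of l] that by simp
        show "p i \<cdot> q \<cdot> a i = Idt C (A i)" using pqa[OF i] Suc.prems(6) i by simp
        show "p l \<cdot> q \<cdot> a i = HZero C (A i) (A l)" if "l \<in> J - {j}" "l \<noteq> i" for l
          using pqa[OF that(1)] Suc.prems(7)[of l i] i that by simp
        show "w l \<cdot> q \<cdot> a i = HZero C (A i) (Z l)" if l: "l \<in> K0 - (K - {k})" for l
        proof (cases "l = k")
          case True
          then show ?thesis
            using Comp_assoc[OF ai q(1) w] wq HZero_Comp[OF ai Hom_Cod_Obj[OF w]] by simp
        next
          case False
          then have l': "l \<in> K0 - K" "l \<in> K0" using l by auto
          note wl = wz(2)[OF l'(2)]
          have 0: "w l \<cdot> a j = HZero C (A j) (Z l)" "w l \<cdot> a i = HZero C (A i) (Z l)"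
            using Suc.prems(8)[OF l'(1)] i j by auto
          have "w l \<cdot> a i = w l \<cdot> HAdd C (a j \<cdot> (c \<cdot> w k)) q \<cdot> a i"
            using q(2) Idt_Comp[OF ai] by simp
          also have "\<dots> = HAdd C ((w l \<cdot> a j) \<cdot> ((c \<cdot> w k) \<cdot> a i)) (w l \<cdot> q \<cdot> a i)"
            using ai aj q(1) wl w c(1) by (simp add: Hom_def)
          also have "\<dots> = w l \<cdot> q \<cdot> a i"
            unfolding 0 HZero_Comp[OF Comp_Hom[OF ai cw] Hom_Cod_Obj[OF wl]]
            by (rule HAdd_HZero(2)[OF Comp_Hom[OF Comp_Hom[OF ai q(1)] wl]])
          finally show ?thesis using 0 by simp
        qed
      qed
      have "card (K - {k}) = n" using k(1) Suc.hyps(2) Suc.prems(1) by simp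
      then show ?thesis using * j Suc.hyps(2) by (auto simp: card_Diff_singleton_if)
    qed simp
  }
qed

end

section \<open>Krull-Schmidt categories\<close>

context additive_krull_schmidt_category
begin

lemma local_resolution:
  assumes "x \<in> Obj C"
  obtains n :: nat and X \<iota> \<pi> where "direct_sum C {..<n} X x \<iota>" "\<And>k. k < n \<Longrightarrow> local_obj C (X k)"
    "\<And>k. k < n \<Longrightarrow> \<pi> k \<in> Hom C x (X k)"
    "\<And>k. k < n \<Longrightarrow> \<pi> k \<cdot> \<iota> k = Idt C (X k)"
    "\<And>k l. k < n \<Longrightarrow> l < n \<Longrightarrow> k \<noteq> l \<Longrightarrow> \<pi> k \<cdot> \<iota> l = HZero C (X l) (X k)"
    "resolution_of_identity C x {..<n} X \<iota> \<pi>"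
proof -
  obtain n :: nat and X \<iota> where X: "direct_sum C {..<n} X x \<iota>"
    and loc: "\<forall>k<n. local_ring (End_ring C (X k))"
    using krull_schmidt[OF assms] by blast
  obtain \<pi> where \<pi>: "\<And>i. i \<in> {..<n} \<Longrightarrow> \<pi> i \<in> Hom C x (X i)"
    "\<And>i. i \<in> {..<n} \<Longrightarrow> \<pi> i \<cdot> \<iota> i = Idt C (X i)"
    "\<And>i j. i \<in> {..<n} \<Longrightarrow> j \<in> {..<n} \<Longrightarrow> i \<noteq> j \<Longrightarrow> \<pi> i \<cdot> \<iota> j = HZero C (X j) (X i)"
    using direct_sum_projections[OF X] by blast
  have "resolution_of_identity C x {..<n} X \<iota> \<pi>"
    using finite_direct_sum_resolution[OF X _ \<pi>] by simp
  moreover have "local_obj C (X k)" if "k < n" for k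
    using local_obj_if_local_ring loc direct_sum_Hom(2)[OF X] that by simp
  ultimately show ?thesis using \<pi> by (intro that[OF X, of \<pi>]) simp_all
qed

text \<open>
  Some component of the nonzero identity of \<open>x\<close> in a decomposition into local objects is nonzero.
\<close>

lemma ex_local_retract:
  assumes "x \<in> Obj C" "Idt C x \<noteq> HZero C x x"
  obtains z a b where "local_obj C z" "a \<in> Hom C z x" "b \<in> Hom C x z" "b \<cdot> a = Idt C z"
    "a \<cdot> b \<noteq> HZero C x x"
proof -
  obtain n :: nat and X \<iota> \<pi> where X: "direct_sum C {..<n} X x \<iota>" "\<And>k. k < n \<Longrightarrow> local_obj C (X k)"
    "\<And>k. k < n \<Longrightarrow> \<pi> k \<in> Hom C x (X k)"
    "\<And>k. k < n \<Longrightarrow> \<pi> k \<cdot> \<iota> k = Idt C (X k)"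
    "resolution_of_identity C x {..<n} X \<iota> \<pi>"
    using local_resolution[OF assms(1)] by metis
  obtain k where "k < n" "\<iota> k \<cdot> \<pi> k \<noteq> HZero C x x"
    using nonzero_resolution[OF X(5) assms(2)] by auto
  then show ?thesis using X direct_sum_Hom(3)[OF X(1)] by (intro that[of "X k" "\<iota> k" "\<pi> k"]) simp_all
qed

text \<open>
  A nonzero local retract of \<open>x\<close> gives a nonzero idempotent, so it is all of \<open>x\<close>. This criterion
  mentions only composition and zero, so that equivalences preserve it.
\<close>

lemma local_obj_if_trivial_idempotents:
  assumes "x \<in> Obj C" "Idt C x \<noteq> HZero C x x"
    and "\<And>e. e \<in> Hom C x x \<Longrightarrow> e \<cdot> e = e \<Longrightarrow> e = Idt C x \<or> e = HZero C x x"
  shows "local_obj C x"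
proof -
  obtain z a b where z: "local_obj C z" "a \<in> Hom C z x" "b \<in> Hom C x z" "b \<cdot> a = Idt C z"
    "a \<cdot> b \<noteq> HZero C x x"
    using ex_local_retract[OF assms(1,2)] by blast
  have "(a \<cdot> b) \<cdot> (a \<cdot> b) = a \<cdot> b"
    using Comp_reassoc[OF z(4,2,3,3)] z by (simp add: Hom_def)
  then have "a \<cdot> b = Idt C x"
    using assms(3) Comp_Hom z by blast
  then have "is_iso C x z b" using z unfolding is_iso_def by blast
  then show ?thesis using local_obj_iso z(1) by blast
qed

text \<open>
  A sub-sum \<open>Y\<close> of a direct sum, built by adding one summand at a time through binary biproducts. It is
  needed because indecomposability speaks of objects: to contradict it, the complement of a local
  summand has to be an object, and idempotents are not assumed to split.
\<close>

lemma ex_partial_direct_sum: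
  assumes P: "direct_sum C I X P \<iota>" and \<pi>: "\<And>i. i \<in> I \<Longrightarrow> \<pi> i \<in> Hom C P (X i)"
    "\<And>i. i \<in> I \<Longrightarrow> \<pi> i \<cdot> \<iota> i = Idt C (X i)"
    "\<And>i j. i \<in> I \<Longrightarrow> j \<in> I \<Longrightarrow> i \<noteq> j \<Longrightarrow> \<pi> i \<cdot> \<iota> j = HZero C (X j) (X i)"
    and "finite K" "K \<subseteq> I"
  shows "\<exists>Y i p. i \<in> Hom C Y P \<and> p \<in> Hom C P Y \<and> p \<cdot> i = Idt C Y \<and>
    (\<forall>l \<in> K. i \<cdot> p \<cdot> \<iota> l = \<iota> l) \<and>
    (\<forall>l \<in> I - K. p \<cdot> \<iota> l = HZero C (X l) Y \<and> \<pi> l \<cdot> i = HZero C Y (X l))"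
  using assms(5,6)
proof (induction K)
  case empty
  obtain z where z: "zero_obj C z" using ex_zero_obj by blast
  then have z': "z \<in> Obj C" "Idt C z = HZero C z z" by (auto simp: zero_obj_iff)
  note D = direct_sum_Hom[OF P]
  have "HZero C P z \<cdot> HZero C z P = Idt C z" using z' D(1) by simp
  moreover have "HZero C P z \<cdot> \<iota> l = HZero C (X l) z \<and> \<pi> l \<cdot> HZero C z P = HZero C z (X l)" if "l \<in> I" for l
    using HZero_Comp[OF D(3)[OF that] z'(1)] Comp_HZero[OF \<pi>(1)[OF that] z'(1)] by simp
  ultimately show ?case using HZero_Hom[OF z'(1) D(1)] HZero_Hom[OF D(1) z'(1)] by blast
next
  case (insert k K)
  note D = direct_sum_Hom[OF P]
  obtain Y i p where Y: "i \<in> Hom C Y P" "p \<in> Hom C P Y" "p \<cdot> i = Idt C Y"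
    "\<And>l. l \<in> K \<Longrightarrow> i \<cdot> p \<cdot> \<iota> l = \<iota> l"
    "\<And>l. l \<in> I - K \<Longrightarrow> p \<cdot> \<iota> l = HZero C (X l) Y" "\<And>l. l \<in> I - K \<Longrightarrow> \<pi> l \<cdot> i = HZero C Y (X l)"
    using insert by auto
  have k: "k \<in> I" "k \<notin> K" "k \<in> I - K" using insert by auto
  note kk = D(3)[OF k(1)] \<pi>(1)[OF k(1)]
  note ob = Hom_Dom_Obj[OF Y(1)] D(2)[OF k(1)] D(1)
  obtain s j1 j2 q1 q2 where bp: "biproduct C (X k) Y s j1 j2 q1 q2"
    using ex_biproduct[OF ob(2,1)] by blast
  note B = bp[unfolded biproduct_def]
  let ?i = "HAdd C (\<iota> k \<cdot> q1) (i \<cdot> q2)" and ?p = "HAdd C (j1 \<cdot> \<pi> k) (j2 \<cdot> p)"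
  have iH: "?i \<in> Hom C s P" and pH: "?p \<in> Hom C P s"
    using B Y(1,2) kk by (auto simp: Hom_def)
  have q: "q1 \<in> Hom C s (X k)" "q2 \<in> Hom C s Y" and jj: "j1 \<in> Hom C (X k) s" "j2 \<in> Hom C Y s"
    using B by auto
  have left: "f \<cdot> ?i = HAdd C ((f \<cdot> \<iota> k) \<cdot> q1) ((f \<cdot> i) \<cdot> q2)" if "f \<in> Hom C P y" for f y
    using that B Y(1) kk by (simp add: Hom_def)
  have right: "?p \<cdot> f = HAdd C (j1 \<cdot> (\<pi> k \<cdot> f)) (j2 \<cdot> (p \<cdot> f))" if "f \<in> Hom C y P" for f y
    using that B Y(2) kk by (simp add: Hom_def)
  have \<pi>i: "\<pi> k \<cdot> ?i = q1"
    unfolding left[OF kk(2)] \<pi>(2)[OF k(1)] Y(6)[OF k(3)]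
      Idt_Comp[OF q(1)] HZero_Comp[OF q(2) ob(2)] by (rule HAdd_HZero(1)[OF q(1)])
  have pi: "p \<cdot> ?i = q2"
    unfolding left[OF Y(2)] Y(3) Y(5)[OF k(3)]
      Idt_Comp[OF q(2)] HZero_Comp[OF q(1) ob(1)] by (rule HAdd_HZero(2)[OF q(2)])
  have "?p \<cdot> ?i = Idt C s" unfolding right[OF iH] \<pi>i pi using B by simp
  moreover have "?p \<cdot> \<iota> l = HZero C (X l) s \<and> \<pi> l \<cdot> ?i = HZero C s (X l)" if "l \<in> I - insert k K" for l
  proof
    have l: "l \<in> I" "l \<in> I - K" "k \<noteq> l" using that by auto
    note Xl = D(2)[OF l(1)] and so = Hom_Cod_Obj[OF pH]
    have "?p \<cdot> \<iota> l = HAdd C (HZero C (X l) s) (HZero C (X l) s)"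
      unfolding right[OF D(3)[OF l(1)]] \<pi>(3)[OF k(1) l(1,3)] Y(5)[OF l(2)]
        Comp_HZero[OF jj(1) Xl] Comp_HZero[OF jj(2) Xl] ..
    then show "?p \<cdot> \<iota> l = HZero C (X l) s" using HAdd_HZero(1)[OF HZero_Hom[OF Xl so]] by simp
    have "\<pi> l \<cdot> ?i = HAdd C (HZero C s (X l)) (HZero C s (X l))"
      unfolding left[OF \<pi>(1)[OF l(1)]] \<pi>(3)[OF l(1) k(1) l(3)[symmetric]] Y(6)[OF l(2)]
        HZero_Comp[OF q(1) Xl] HZero_Comp[OF q(2) Xl] ..
    then show "\<pi> l \<cdot> ?i = HZero C s (X l)" using HAdd_HZero(1)[OF HZero_Hom[OF so Xl]] by simp
  qed
  moreover have "?i \<cdot> ?p \<cdot> \<iota> l = \<iota> l" if l: "l \<in> insert k K" for l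
  proof -
    have lI: "l \<in> I" using l insert by auto
    note \<iota>l = D(3)[OF lI]
    note \<pi>l = Comp_Hom[OF \<iota>l kk(2)] and pl = Comp_Hom[OF \<iota>l Y(2)]
    have bq: "q1 \<cdot> ?p = \<pi> k" "q2 \<cdot> ?p = p"
      using B Y(2) kk Comp_reassoc[of q1 j1 "Idt C (X k)" "X k" s "X k" "\<pi> k" P]
        Comp_reassoc[of q1 j2 "HZero C Y (X k)" Y s "X k" "p" P]
        Comp_reassoc[of q2 j1 "HZero C (X k) Y" "X k" s Y "\<pi> k" P]
        Comp_reassoc[of q2 j2 "Idt C Y" Y s Y "p" P]
      by (simp_all add: Hom_def)
    have "?i \<cdot> ?p \<cdot> \<iota> l = HAdd C ((\<iota> k \<cdot> q1) \<cdot> ?p \<cdot> \<iota> l) ((i \<cdot> q2) \<cdot> ?p \<cdot> \<iota> l)"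
      by (rule Comp_HAdd[OF Comp_Hom[OF \<iota>l pH] Comp_Hom[OF q(1) kk(1)] Comp_Hom[OF q(2) Y(1)]])
    also have "(\<iota> k \<cdot> q1) \<cdot> ?p \<cdot> \<iota> l = \<iota> k \<cdot> ((q1 \<cdot> ?p) \<cdot> \<iota> l)"
      unfolding Comp_assoc[OF Comp_Hom[OF \<iota>l pH] q(1) kk(1)] Comp_assoc[OF \<iota>l pH q(1)] ..
    also have "(i \<cdot> q2) \<cdot> ?p \<cdot> \<iota> l = i \<cdot> ((q2 \<cdot> ?p) \<cdot> \<iota> l)"
      unfolding Comp_assoc[OF Comp_Hom[OF \<iota>l pH] q(2) Y(1)] Comp_assoc[OF \<iota>l pH q(2)] ..
    finally have "?i \<cdot> ?p \<cdot> \<iota> l = HAdd C (\<iota> k \<cdot> ((q1 \<cdot> ?p) \<cdot> \<iota> l)) (i \<cdot> ((q2 \<cdot> ?p) \<cdot> \<iota> l))" .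
    then have eq: "?i \<cdot> ?p \<cdot> \<iota> l = HAdd C (\<iota> k \<cdot> (\<pi> k \<cdot> \<iota> l)) (i \<cdot> (p \<cdot> \<iota> l))"
      unfolding bq .
    show ?thesis
    proof (cases "l = k")
      case True
      then show ?thesis
        using eq \<pi>(2)[OF k(1)] Y(5)[OF k(3)] Comp_HZero[OF Y(1) ob(2)] Comp_Idt[OF kk(1)]
          HAdd_HZero(1)[OF kk(1)] by simp
    next
      case False
      then have "l \<in> K" using l by simp
      then show ?thesis
        using eq \<pi>(3)[OF k(1) lI] False Y(4) Comp_HZero[OF kk(1) D(2)[OF lI]] HAdd_HZero(2)[OF \<iota>l] by simp
    qed
  qed
  ultimately show ?case using iH pH by blast
qed

text \<open>
  One local summand and the sum \<open>Y\<close> of the others form a biproduct, so \<open>Y\<close> is zero and \<open>W\<close> is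
  isomorphic to the local summand.
\<close>

lemma indecomposable_imp_local:
  assumes W: "indecomposable_obj C W"
  shows "local_obj C W"
proof -
  have W': "W \<in> Obj C" "Idt C W \<noteq> HZero C W W"
    using W zero_obj_iff by (auto simp: indecomposable_obj_def)
  obtain n :: nat and X \<iota> \<pi> where X: "direct_sum C {..<n} X W \<iota>" "\<And>k. k < n \<Longrightarrow> local_obj C (X k)"
    and \<pi>: "\<And>k. k < n \<Longrightarrow> \<pi> k \<in> Hom C W (X k)"
    "\<And>k. k < n \<Longrightarrow> \<pi> k \<cdot> \<iota> k = Idt C (X k)"
    "\<And>k l. k < n \<Longrightarrow> l < n \<Longrightarrow> k \<noteq> l \<Longrightarrow> \<pi> k \<cdot> \<iota> l = HZero C (X l) (X k)"
    and res: "resolution_of_identity C W {..<n} X \<iota> \<pi>"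
    using local_resolution[OF W'(1)] by metis
  obtain k where k: "k < n"
    using nonzero_resolution[OF res W'(2)] by auto
  let ?K = "{..<n} - {k}"
  obtain Y i p where Y: "i \<in> Hom C Y W" "p \<in> Hom C W Y" "p \<cdot> i = Idt C Y"
    "\<And>l. l \<in> ?K \<Longrightarrow> i \<cdot> p \<cdot> \<iota> l = \<iota> l"
    "p \<cdot> \<iota> k = HZero C (X k) Y" "\<pi> k \<cdot> i = HZero C Y (X k)"
    using ex_partial_direct_sum[OF X(1), of \<pi> ?K] \<pi> k by auto
  note D = direct_sum_Hom[OF X(1)]
  have kk: "\<iota> k \<in> Hom C (X k) W" "\<pi> k \<in> Hom C W (X k)" using D(3) \<pi>(1) k by auto
  have sum: "HAdd C (\<iota> k \<cdot> \<pi> k) (i \<cdot> p) = Idt C W"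
  proof (rule direct_sum_ext[OF X(1) category_axioms])
    show "HAdd C (\<iota> k \<cdot> \<pi> k) (i \<cdot> p) \<in> Hom C W W" "Idt C W \<in> Hom C W W"
      using kk Y(1,2) W'(1) by (auto simp: Hom_def)
    fix l assume l: "l \<in> {..<n}"
    note \<iota>l = D(3)[OF l]
    have eq: "HAdd C (\<iota> k \<cdot> \<pi> k) (i \<cdot> p) \<cdot> \<iota> l = HAdd C (\<iota> k \<cdot> (\<pi> k \<cdot> \<iota> l)) (i \<cdot> (p \<cdot> \<iota> l))"
      using kk Y(1,2) \<iota>l by (simp add: Hom_def)
    show "HAdd C (\<iota> k \<cdot> \<pi> k) (i \<cdot> p) \<cdot> \<iota> l = Idt C W \<cdot> \<iota> l"
    proof (cases "l = k")
      case True
      then show ?thesis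
        using eq \<pi>(2)[OF k] Y(5) Comp_HZero[OF Y(1) D(2)] l Comp_Idt[OF kk(1)]
          HAdd_HZero(1)[OF kk(1)] Idt_Comp[OF kk(1)] by simp
    next
      case False
      then show ?thesis
        using eq \<pi>(3)[OF k, of l] l Y(4) Comp_HZero[OF kk(1) D(2)[OF l]] HAdd_HZero(2)[OF \<iota>l]
          Idt_Comp[OF \<iota>l] by simp
    qed
  qed
  have "biproduct C (X k) Y W (\<iota> k) i (\<pi> k) p"
    unfolding biproduct_def using kk Y \<pi>(2)[OF k] sum W'(1) D(2) k Hom_Dom_Obj[OF Y(1)] by simp
  then have "zero_obj C (X k) \<or> zero_obj C Y"
    using W unfolding indecomposable_obj_def by blast
  moreover have "\<not> zero_obj C (X k)"
    using X(2)[OF k] by (simp add: local_obj_def zero_obj_iff)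
  ultimately have "Idt C Y = HZero C Y Y" and Yo: "Y \<in> Obj C" by (auto simp: zero_obj_iff)
  then have "p = HZero C W Y"
    using Idt_Comp[OF Y(2)] HZero_Comp[OF Y(2) Yo] by simp
  then have "i \<cdot> p = HZero C W W" using Comp_HZero[OF Y(1) W'(1)] by simp
  then have "\<iota> k \<cdot> \<pi> k = Idt C W"
    using sum HAdd_HZero(1)[OF Comp_Hom[OF kk(2,1)]] by simp
  then have "is_iso C W (X k) (\<pi> k)"
    unfolding is_iso_def using kk \<pi>(2)[OF k] by blast
  then show ?thesis using local_obj_iso X(2)[OF k] by blast
qed

end

section \<open>Self-equivalences\<close>

lemma is_functorD:
  assumes F: "is_functor C D F" and C: "category C"
  shows "x \<in> Obj C \<Longrightarrow> ob F x \<in> Obj D"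
    and "f \<in> Hom C x y \<Longrightarrow> ar F f \<in> Hom D (ob F x) (ob F y)"
    and "x \<in> Obj C \<Longrightarrow> ar F (Idt C x) = Idt D (ob F x)"
    and "f \<in> Hom C x y \<Longrightarrow> g \<in> Hom C y z \<Longrightarrow> ar F (g \<cdot>\<^bsub>C\<^esub> f) = ar F g \<cdot>\<^bsub>D\<^esub> ar F f"
proof -
  interpret category C by (rule C)
  show "x \<in> Obj C \<Longrightarrow> ob F x \<in> Obj D" "x \<in> Obj C \<Longrightarrow> ar F (Idt C x) = Idt D (ob F x)"
    using F unfolding is_functor_def by simp_all
  show "f \<in> Hom C x y \<Longrightarrow> ar F f \<in> Hom D (ob F x) (ob F y)"
    using F Hom_Dom_Obj[of f x y] Hom_Cod_Obj[of f x y] unfolding is_functor_def by simp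
  show "f \<in> Hom C x y \<Longrightarrow> g \<in> Hom C y z \<Longrightarrow> ar F (g \<cdot>\<^bsub>C\<^esub> f) = ar F g \<cdot>\<^bsub>D\<^esub> ar F f"
    using F Hom_Dom_Obj[of f x y] Hom_Cod_Obj[of f x y] Hom_Cod_Obj[of g y z]
    unfolding is_functor_def by simp
qed

lemma self_equivalence_inverse:
  assumes "self_equivalence C E"
  obtains E' where "self_equivalence C E'" "nat_isomorphic C C (E' \<circ>\<^sub>F E) id_functor"
  using assms unfolding self_equivalence_def by blast

context category
begin

lemma nat_isomorphic_id:
  assumes "nat_isomorphic C C (E' \<circ>\<^sub>F E) id_functor"
  obtains \<tau> where "\<And>x. x \<in> Obj C \<Longrightarrow> is_iso C (ob E' (ob E x)) x (\<tau> x)"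
    "\<And>f x y. f \<in> Hom C x y \<Longrightarrow> f \<cdot> \<tau> x = \<tau> y \<cdot> ar E' (ar E f)"
proof -
  obtain \<tau> where "nat_trans C C (E' \<circ>\<^sub>F E) id_functor \<tau>"
    "\<forall>x \<in> Obj C. is_iso C (ob E' (ob E x)) x (\<tau> x)"
    using assms unfolding nat_isomorphic_def by (auto simp: comp_functor_def id_functor_def)
  then show ?thesis
    using Hom_Dom_Obj Hom_Cod_Obj
    by (intro that[of \<tau>]) (auto simp: nat_trans_def comp_functor_def id_functor_def)
qed

lemma self_equivalence_faithful:
  assumes E: "self_equivalence C E" and f: "f \<in> Hom C x y" and g: "g \<in> Hom C x y"
    and eq: "ar E f = ar E g"
  shows "f = g"
proof -
  obtain E' where "nat_isomorphic C C (E' \<circ>\<^sub>F E) id_functor"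
    using E by (rule self_equivalence_inverse)
  then obtain \<tau> where \<tau>: "\<And>x. x \<in> Obj C \<Longrightarrow> is_iso C (ob E' (ob E x)) x (\<tau> x)"
    "\<And>f x y. f \<in> Hom C x y \<Longrightarrow> f \<cdot> \<tau> x = \<tau> y \<cdot> ar E' (ar E f)"
    by (rule nat_isomorphic_id) blast
  note \<tau>x = \<tau>(1)[OF Hom_Dom_Obj[OF f]]
  obtain \<sigma> where \<sigma>: "\<sigma> \<in> Hom C x (ob E' (ob E x))" "\<tau> x \<cdot> \<sigma> = Idt C x"
    using \<tau>x by (rule is_isoE)
  have "f \<cdot> \<tau> x = g \<cdot> \<tau> x" using \<tau>(2)[OF f] \<tau>(2)[OF g] eq by simp
  then have "f \<cdot> \<tau> x \<cdot> \<sigma> = g \<cdot> \<tau> x \<cdot> \<sigma>"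
    using Comp_assoc[OF \<sigma>(1) is_iso_Hom[OF \<tau>x] f] Comp_assoc[OF \<sigma>(1) is_iso_Hom[OF \<tau>x] g] by simp
  then show ?thesis using \<sigma>(2) Comp_Idt[OF f] Comp_Idt[OF g] by simp
qed

text \<open>
  The preimage of \<open>g\<close> is \<open>E' g\<close> conjugated by the isomorphism \<open>\<tau> : E' E \<cong> 1\<close>. Its image under \<open>E' E\<close> is
  then \<open>E' g\<close>, and \<open>E'\<close> is faithful because it is a self-equivalence as well.
\<close>

lemma self_equivalence_full:
  assumes E: "self_equivalence C E" and g: "g \<in> Hom C (ob E x) (ob E y)"
    and x: "x \<in> Obj C" and y: "y \<in> Obj C"
  obtains f where "f \<in> Hom C x y" "ar E f = g"
proof -
  obtain E' where E': "self_equivalence C E'" and "nat_isomorphic C C (E' \<circ>\<^sub>F E) id_functor"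
    using E by (rule self_equivalence_inverse)
  then obtain \<tau> where \<tau>: "\<And>x. x \<in> Obj C \<Longrightarrow> is_iso C (ob E' (ob E x)) x (\<tau> x)"
    "\<And>f x y. f \<in> Hom C x y \<Longrightarrow> f \<cdot> \<tau> x = \<tau> y \<cdot> ar E' (ar E f)"
    using nat_isomorphic_id by blast
  have F: "is_functor C C E" "is_functor C C E'" using E E' by (simp_all add: self_equivalence_def)
  note EH = is_functorD(2)[OF F(1) category_axioms] and E'H = is_functorD(2)[OF F(2) category_axioms]
  note \<tau>x = is_iso_Hom[OF \<tau>(1)[OF x]] and \<tau>y = is_iso_Hom[OF \<tau>(1)[OF y]]
  obtain \<sigma> where \<sigma>: "\<sigma> \<in> Hom C x (ob E' (ob E x))" "\<sigma> \<cdot> \<tau> x = Idt C (ob E' (ob E x))"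
    using \<tau>(1)[OF x] by (rule is_isoE)
  obtain \<rho> where \<rho>: "\<rho> \<in> Hom C y (ob E' (ob E y))" "\<rho> \<cdot> \<tau> y = Idt C (ob E' (ob E y))"
    using \<tau>(1)[OF y] by (rule is_isoE)
  let ?f = "\<tau> y \<cdot> ar E' g \<cdot> \<sigma>"
  note g' = E'H[OF g]
  have f: "?f \<in> Hom C x y" using Comp_Hom[OF Comp_Hom[OF \<sigma>(1) g'] \<tau>y] .
  note f' = E'H[OF EH[OF f]]
  have "?f \<cdot> \<tau> x = \<tau> y \<cdot> ar E' g \<cdot> (\<sigma> \<cdot> \<tau> x)"
    using \<tau>x \<tau>y \<sigma>(1) g' by (simp add: Hom_def)
  then have "\<tau> y \<cdot> ar E' (ar E ?f) = \<tau> y \<cdot> ar E' g"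
    using \<tau>(2)[OF f] \<sigma>(2) Comp_Idt[OF g'] by simp
  then have "(\<rho> \<cdot> \<tau> y) \<cdot> ar E' (ar E ?f) = (\<rho> \<cdot> \<tau> y) \<cdot> ar E' g"
    using Comp_assoc[OF f' \<tau>y \<rho>(1)] Comp_assoc[OF g' \<tau>y \<rho>(1)] by simp
  then have "ar E' (ar E ?f) = ar E' g"
    using \<rho>(2) Idt_Comp[OF f'] Idt_Comp[OF g'] by simp
  then have "ar E ?f = g" by (rule self_equivalence_faithful[OF E' EH[OF f] g])
  then show ?thesis using that f by blast
qed

lemma self_equivalence_reflects_split_mono:
  assumes E: "self_equivalence C E" and f: "f \<in> Hom C x y"
    and sm: "split_mono C (ob E x) (ob E y) (ar E f)"
  shows "split_mono C x y f"
proof -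
  note ob = Hom_Dom_Obj[OF f] Hom_Cod_Obj[OF f]
  have F: "is_functor C C E" using E by (simp add: self_equivalence_def)
  note F = is_functorD[OF F category_axioms]
  obtain g' where g': "g' \<in> Hom C (ob E y) (ob E x)" "g' \<cdot> ar E f = Idt C (ob E x)"
    using sm unfolding split_mono_def by blast
  obtain g where g: "g \<in> Hom C y x" "ar E g = g'"
    using self_equivalence_full[OF E g'(1) ob(2,1)] by blast
  have "ar E (g \<cdot> f) = ar E (Idt C x)" using F(4)[OF f g(1)] F(3)[OF ob(1)] g g' by simp
  then have "g \<cdot> f = Idt C x"
    by (rule self_equivalence_faithful[OF E Comp_Hom[OF f g(1)] Idt_Hom[OF ob(1)]])
  then show ?thesis using f g(1) unfolding split_mono_def by blast
qed

end

text \<open>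
  The zero endomorphism is the absorbing element of the endomorphism monoid, and \<open>E\<close> is full.
\<close>

lemma (in preadditive_category) self_equivalence_HZero:
  assumes E: "self_equivalence C E" and x: "x \<in> Obj C"
  shows "ar E (HZero C x x) = HZero C (ob E x) (ob E x)"
proof -
  have F: "is_functor C C E" using E by (simp add: self_equivalence_def)
  note F = is_functorD[OF F category_axioms]
  note Ex = F(1)[OF x] and 0 = HZero_Hom[OF x x]
  obtain f where f: "f \<in> Hom C x x" "ar E f = HZero C (ob E x) (ob E x)"
    using self_equivalence_full[OF E HZero_Hom[OF Ex Ex] x x] by blast
  have "ar E (HZero C x x) = ar E (HZero C x x \<cdot> f)" using HZero_Comp[OF f(1) x] by simp
  also have "\<dots> = ar E (HZero C x x) \<cdot> HZero C (ob E x) (ob E x)"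
    using F(4)[OF f(1) 0] f(2) by simp
  also have "\<dots> = HZero C (ob E x) (ob E x)" by (rule Comp_HZero[OF F(2)[OF 0] Ex])
  finally show ?thesis .
qed

text \<open>
  The monoids of endomorphisms of \<open>x\<close> and \<open>E x\<close> are isomorphic, so they have the same idempotents.
\<close>

lemma (in additive_krull_schmidt_category) self_equivalence_local:
  assumes E: "self_equivalence C E" and x: "local_obj C x"
  shows "local_obj C (ob E x)"
proof (rule local_obj_if_trivial_idempotents)
  have xo: "x \<in> Obj C" "Idt C x \<noteq> HZero C x x" using x by (auto simp: local_obj_def)
  have F: "is_functor C C E" using E by (simp add: self_equivalence_def)
  note F = is_functorD[OF F category_axioms]
  note inj = self_equivalence_faithful[OF E]
  note E0 = self_equivalence_HZero[OF E xo(1)]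
  show "ob E x \<in> Obj C" by (rule F(1)[OF xo(1)])
  show "Idt C (ob E x) \<noteq> HZero C (ob E x) (ob E x)"
    using inj[OF Idt_Hom[OF xo(1)] HZero_Hom[OF xo(1) xo(1)]] xo(2) E0 F(3)[OF xo(1)] by auto
  fix e assume e: "e \<in> Hom C (ob E x) (ob E x)" "e \<cdot> e = e"
  obtain d where d: "d \<in> Hom C x x" "ar E d = e"
    using self_equivalence_full[OF E e(1) xo(1) xo(1)] by blast
  have "ar E (d \<cdot> d) = ar E d" using F(4)[OF d(1) d(1)] d(2) e(2) by simp
  then have "d \<cdot> d = d" by (rule inj[OF Comp_Hom[OF d(1) d(1)] d(1)])
  then have "d = Idt C x \<or> d = HZero C x x" by (rule local_obj_idempotent[OF x d(1)])
  then show "e = Idt C (ob E x) \<or> e = HZero C (ob E x) (ob E x)"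
    using d(2) F(3)[OF xo(1)] E0 by auto
qed

section \<open>Adjunctions whose monad is a sum of self-equivalences\<close>

text \<open>
  An adjunction together with a decomposition of \<open>T S\<close>, with the hom-bijections \<open>\<phi>\<close> and the
  inclusions \<open>\<iota>\<close> of the summands named.
\<close>

locale adjunction_with_equivalence_sum =
  H: additive_krull_schmidt_category H + G: additive_category G
  for H :: "('o1, 'm1) preadd_cat" and G :: "('o2, 'm2) preadd_cat" +
  fixes S :: "('o1, 'm1, 'o2, 'm2) fctr" and T :: "('o2, 'm2, 'o1, 'm1) fctr"
    and I :: "'i set" and E :: "'i \<Rightarrow> ('o1, 'm1, 'o1, 'm1) fctr"
    and \<phi> :: "'o1 \<Rightarrow> 'o2 \<Rightarrow> 'm2 \<Rightarrow> 'm1" and \<iota> :: "'i \<Rightarrow> 'o1 \<Rightarrow> 'm1"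
  assumes functor_S: "is_functor H G S" and functor_T: "is_functor G H T"
    and \<phi>_bij: "\<lbrakk>x \<in> Obj H; y \<in> Obj G\<rbrakk> \<Longrightarrow> bij_betw (\<phi> x y) (Hom G (ob S x) y) (Hom H x (ob T y))"
    and \<phi>_natural: "\<lbrakk>f \<in> Hom H x' x; g \<in> Hom G y y'; h \<in> Hom G (ob S x) y\<rbrakk> \<Longrightarrow>
      \<phi> x' y' (g \<cdot>\<^bsub>G\<^esub> h \<cdot>\<^bsub>G\<^esub> ar S f) = ar T g \<cdot>\<^bsub>H\<^esub> \<phi> x y h \<cdot>\<^bsub>H\<^esub> f"
    and equivalence_E: "i \<in> I \<Longrightarrow> self_equivalence H (E i)"
    and \<iota>_natural: "i \<in> I \<Longrightarrow> nat_trans H H (E i) (T \<circ>\<^sub>F S) (\<iota> i)"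
    and TS_sum: "x \<in> Obj H \<Longrightarrow> direct_sum H I (\<lambda>i. ob (E i) x) (ob T (ob S x)) (\<lambda>i. \<iota> i x)"
begin

lemmas S = is_functorD[OF functor_S H.category_axioms]
lemmas T = is_functorD[OF functor_T G.category_axioms]

lemma \<phi>_Hom: "x \<in> Obj H \<Longrightarrow> h \<in> Hom G (ob S x) y \<Longrightarrow> \<phi> x y h \<in> Hom H x (ob T y)"
  using bij_betwE[OF \<phi>_bij] G.Hom_Cod_Obj by blast

lemma \<phi>_inj:
  assumes "x \<in> Obj H" "h \<in> Hom G (ob S x) y" "h' \<in> Hom G (ob S x) y" "\<phi> x y h = \<phi> x y h'"
  shows "h = h'"
  using \<phi>_bij[OF assms(1) G.Hom_Cod_Obj[OF assms(2)]] assms by (auto simp: bij_betw_def dest: inj_onD)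

lemma \<phi>_surj:
  assumes "k \<in> Hom H x (ob T y)" "y \<in> Obj G"
  obtains h where "h \<in> Hom G (ob S x) y" "\<phi> x y h = k"
proof -
  have "k \<in> \<phi> x y ` Hom G (ob S x) y"
    using bij_betw_imp_surj_on[OF \<phi>_bij[OF H.Hom_Dom_Obj[OF assms(1)] assms(2)]] assms(1) by simp
  then show ?thesis by (rule imageE) (use that in simp)
qed

lemma \<phi>_Comp:
  assumes x: "x \<in> Obj H" and h: "h \<in> Hom G (ob S x) y" and g: "g \<in> Hom G y y'"
  shows "\<phi> x y' (g \<cdot>\<^bsub>G\<^esub> h) = ar T g \<cdot>\<^bsub>H\<^esub> \<phi> x y h"
  using \<phi>_natural[OF H.Idt_Hom[OF x] g h] S(3)[OF x] G.Comp_Idt[OF h] H.Comp_Idt[OF \<phi>_Hom[OF x h]]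
  by simp

lemma \<phi>_Comp_S:
  assumes f: "f \<in> Hom H x' x" and h: "h \<in> Hom G (ob S x) y"
  shows "\<phi> x' y (h \<cdot>\<^bsub>G\<^esub> ar S f) = \<phi> x y h \<cdot>\<^bsub>H\<^esub> f"
proof -
  note y = G.Hom_Cod_Obj[OF h]
  show ?thesis
    using \<phi>_natural[OF f G.Idt_Hom[OF y] h] T(3)[OF y] G.Idt_Comp[OF G.Comp_Hom[OF S(2)[OF f] h]]
      H.Idt_Comp[OF H.Comp_Hom[OF f \<phi>_Hom[OF H.Hom_Cod_Obj[OF f] h]]]
    by simp
qed

text \<open>
  All maps into \<open>T z\<close> from a given object correspond to maps into the terminal object \<open>z\<close>, so any
  two of them agree.
\<close>

lemma T_zero_obj:
  assumes z: "zero_obj G z"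
  shows "Idt H (ob T z) = HZero H (ob T z) (ob T z)"
proof -
  have zo: "z \<in> Obj G" using z by (simp add: zero_obj_def)
  note Tz = T(1)[OF zo]
  obtain h where h: "h \<in> Hom G (ob S (ob T z)) z" "\<phi> (ob T z) z h = Idt H (ob T z)"
    using \<phi>_surj[OF H.Idt_Hom[OF Tz] zo] by blast
  obtain h' where h': "h' \<in> Hom G (ob S (ob T z)) z" "\<phi> (ob T z) z h' = HZero H (ob T z) (ob T z)"
    using \<phi>_surj[OF H.HZero_Hom[OF Tz Tz] zo] by blast
  have "\<exists>!f. f \<in> Hom G (ob S (ob T z)) z" using z S(1)[OF Tz] by (simp add: zero_obj_def)
  then have "h = h'" using h h' by blast
  then show ?thesis using h h' by simp
qed

text \<open>
  Additivity of the bijection \<open>\<phi>\<close> is not part of the definition of an adjoint pair. That it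
  preserves zero follows from factoring the zero morphism through a zero object.
\<close>

lemma \<phi>_HZero:
  assumes x: "x \<in> Obj H" and y: "y \<in> Obj G"
  shows "\<phi> x y (HZero G (ob S x) y) = HZero H x (ob T y)"
proof -
  obtain z where z: "zero_obj G z" using G.ex_zero_obj by blast
  have zo: "z \<in> Obj G" using z by (simp add: zero_obj_def)
  note 0 = G.HZero_Hom[OF S(1)[OF x] zo] G.HZero_Hom[OF zo y]
  let ?k = "\<phi> x z (HZero G (ob S x) z)"
  note k = \<phi>_Hom[OF x 0(1)]
  have "?k = HZero H x (ob T z)"
    using H.Idt_Comp[OF k] T_zero_obj[OF z] H.HZero_Comp[OF k T(1)[OF zo]] by simp
  then have "\<phi> x y (HZero G z y \<cdot>\<^bsub>G\<^esub> HZero G (ob S x) z) = HZero H x (ob T y)"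
    using \<phi>_Comp[OF x 0] H.Comp_HZero[OF T(2)[OF 0(2)] x] by simp
  then show ?thesis using G.Comp_HZero[OF 0(2) S(1)[OF x]] by simp
qed

lemma T_nonzero:
  assumes x: "x \<in> Obj H" and p: "p \<in> Hom G (ob S x) y" "p \<noteq> HZero G (ob S x) y"
  shows "Idt H (ob T y) \<noteq> HZero H (ob T y) (ob T y)"
proof
  assume 0: "Idt H (ob T y) = HZero H (ob T y) (ob T y)"
  note y = G.Hom_Cod_Obj[OF p(1)]
  note k = \<phi>_Hom[OF x p(1)]
  have "\<phi> x y p = HZero H x (ob T y)"
    using H.Idt_Comp[OF k] 0 H.HZero_Comp[OF k T(1)[OF y]] by simp
  then show False
    using \<phi>_inj[OF x p(1) G.HZero_Hom[OF S(1)[OF x] y]] \<phi>_HZero[OF x y] p(2) by simp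
qed

text \<open>
  Here \<open>\<epsilon>\<close> is the counit at \<open>y\<close>, through which every morphism \<open>h\<close> factors as \<open>\<epsilon> \<cdot> S (\<phi> h)\<close>.
\<close>

lemma T_via_counit:
  assumes y: "y \<in> Obj G"
  obtains \<epsilon> where "\<epsilon> \<in> Hom G (ob S (ob T y)) y"
    "\<And>x h. x \<in> Obj H \<Longrightarrow> h \<in> Hom G (ob S x) y \<Longrightarrow>
      ar T h = ar T \<epsilon> \<cdot>\<^bsub>H\<^esub> ar T (ar S (\<phi> x y h))"
proof -
  obtain \<epsilon> where \<epsilon>: "\<epsilon> \<in> Hom G (ob S (ob T y)) y" "\<phi> (ob T y) y \<epsilon> = Idt H (ob T y)"
    using \<phi>_surj[OF H.Idt_Hom[OF T(1)[OF y]] y] by blast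
  have "ar T h = ar T \<epsilon> \<cdot>\<^bsub>H\<^esub> ar T (ar S (\<phi> x y h))" if x: "x \<in> Obj H" and h: "h \<in> Hom G (ob S x) y" for x h
  proof -
    note k = \<phi>_Hom[OF x h]
    have "\<phi> x y (\<epsilon> \<cdot>\<^bsub>G\<^esub> ar S (\<phi> x y h)) = \<phi> x y h"
      using \<phi>_Comp_S[OF k \<epsilon>(1)] \<epsilon>(2) H.Idt_Comp[OF k] by simp
    then have "\<epsilon> \<cdot>\<^bsub>G\<^esub> ar S (\<phi> x y h) = h"
      by (rule \<phi>_inj[OF x G.Comp_Hom[OF S(2)[OF k] \<epsilon>(1)] h])
    then show ?thesis using T(4)[OF S(2)[OF k] \<epsilon>(1)] by simp
  qed
  then show ?thesis using that \<epsilon>(1) by blast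
qed

text \<open>
  By naturality of \<open>\<iota>\<close> the factorisation of \<open>T h\<close> through \<open>T S (\<phi> h)\<close> restricts on the summand \<open>E\<^sub>i x\<close> to
  one through \<open>E\<^sub>i (\<phi> h)\<close>. The latter is therefore a split monomorphism, and \<open>E\<^sub>i\<close> reflects this
  property.
\<close>

lemma \<phi>_split_mono:
  assumes x: "x \<in> Obj H" and h: "h \<in> Hom G (ob S x) y" and i: "i \<in> I"
    and sm: "split_mono H (ob (E i) x) (ob T y) (ar T h \<cdot>\<^bsub>H\<^esub> \<iota> i x)"
  shows "split_mono H x (ob T y) (\<phi> x y h)"
proof -
  note k = \<phi>_Hom[OF x h]
  note y = G.Hom_Cod_Obj[OF h]
  obtain \<epsilon> where \<epsilon>: "\<epsilon> \<in> Hom G (ob S (ob T y)) y"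
    "ar T h = ar T \<epsilon> \<cdot>\<^bsub>H\<^esub> ar T (ar S (\<phi> x y h))"
    using T_via_counit[OF y] x h by metis
  have F: "is_functor H H (E i)" using equivalence_E[OF i] by (simp add: self_equivalence_def)
  note Ek = is_functorD(2)[OF F H.category_axioms k]
  note \<iota> = direct_sum_Hom(3)[OF TS_sum i]
  note TSk = T(2)[OF S(2)[OF k]] and T\<epsilon> = T(2)[OF \<epsilon>(1)]
  have "ar T (ar S (\<phi> x y h)) \<cdot>\<^bsub>H\<^esub> \<iota> i x = \<iota> i (ob T y) \<cdot>\<^bsub>H\<^esub> ar (E i) (\<phi> x y h)"
    using \<iota>_natural[OF i] k x T(1)[OF y] unfolding nat_trans_def comp_functor_def by simp
  then have "ar T h \<cdot>\<^bsub>H\<^esub> \<iota> i x = (ar T \<epsilon> \<cdot>\<^bsub>H\<^esub> \<iota> i (ob T y)) \<cdot>\<^bsub>H\<^esub> ar (E i) (\<phi> x y h)"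
    using H.Comp_assoc[OF \<iota>[OF x] TSk T\<epsilon>] H.Comp_assoc[OF Ek \<iota>[OF T(1)[OF y]] T\<epsilon>] \<epsilon>(2) by simp
  then have "split_mono H (ob (E i) x) (ob (E i) (ob T y)) (ar (E i) (\<phi> x y h))"
    using H.split_mono_Comp_left[OF _ Ek H.Comp_Hom[OF \<iota>[OF T(1)[OF y]] T\<epsilon>]] sm by simp
  then show ?thesis
    by (rule H.self_equivalence_reflects_split_mono[OF equivalence_E[OF i] k])
qed

lemma E_local: "i \<in> I \<Longrightarrow> local_obj H W \<Longrightarrow> local_obj H (ob (E i) W)"
  using H.self_equivalence_local[OF equivalence_E] .

lemma finite_index:
  assumes W: "local_obj H W"
  shows "finite I"
proof -
  have Wo: "W \<in> Obj H" using W by (simp add: local_obj_def)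
  note P = TS_sum[OF Wo]
  obtain \<pi> where \<pi>: "\<And>i. i \<in> I \<Longrightarrow> \<pi> i \<in> Hom H (ob T (ob S W)) (ob (E i) W)"
    "\<And>i. i \<in> I \<Longrightarrow> \<pi> i \<cdot>\<^bsub>H\<^esub> \<iota> i W = Idt H (ob (E i) W)"
    "\<And>i j. i \<in> I \<Longrightarrow> j \<in> I \<Longrightarrow> i \<noteq> j \<Longrightarrow> \<pi> i \<cdot>\<^bsub>H\<^esub> \<iota> j W = HZero H (ob (E j) W) (ob (E i) W)"
    using H.direct_sum_projections[OF P] by blast
  obtain n :: nat and X z w where X: "\<And>k. k < n \<Longrightarrow> local_obj H (X k)"
    and res: "resolution_of_identity H (ob T (ob S W)) {..<n} X z w"
    using H.local_resolution[OF direct_sum_Hom(1)[OF P]] by metis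
  have "finite I \<and> card I \<le> card {..<n}"
    using X E_local[OF _ W] direct_sum_Hom(3)[OF P] \<pi>
    by (intro H.card_orthogonal_local_retracts_le[OF res, of "{..<n}" I "\<lambda>i. ob (E i) W" "\<lambda>i. \<iota> i W" \<pi>])
      auto
  then show ?thesis by simp
qed

lemma TS_resolution:
  assumes W: "local_obj H W"
  obtains \<pi> where "\<And>i. i \<in> I \<Longrightarrow> \<pi> i \<in> Hom H (ob T (ob S W)) (ob (E i) W)"
    "\<And>i. i \<in> I \<Longrightarrow> \<pi> i \<cdot>\<^bsub>H\<^esub> \<iota> i W = Idt H (ob (E i) W)"
    "resolution_of_identity H (ob T (ob S W)) I (\<lambda>i. ob (E i) W) (\<lambda>i. \<iota> i W) \<pi>"
proof -
  have Wo: "W \<in> Obj H" using W by (simp add: local_obj_def)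
  note P = TS_sum[OF Wo]
  obtain \<pi> where \<pi>: "\<And>i. i \<in> I \<Longrightarrow> \<pi> i \<in> Hom H (ob T (ob S W)) (ob (E i) W)"
    "\<And>i. i \<in> I \<Longrightarrow> \<pi> i \<cdot>\<^bsub>H\<^esub> \<iota> i W = Idt H (ob (E i) W)"
    "\<And>i j. i \<in> I \<Longrightarrow> j \<in> I \<Longrightarrow> i \<noteq> j \<Longrightarrow> \<pi> i \<cdot>\<^bsub>H\<^esub> \<iota> j W = HZero H (ob (E j) W) (ob (E i) W)"
    using H.direct_sum_projections[OF P] by blast
  show ?thesis
    using that \<pi>(1,2) H.finite_direct_sum_resolution[OF P finite_index[OF W] \<pi>] by blast
qed

text \<open>
  The object \<open>T X\<close> is nonzero and has a local retract \<open>Z\<close>, which is also a retract of \<open>T S W\<close>. The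
  identity of \<open>Z\<close> then comes from a single summand \<open>E\<^sub>k W\<close>, isomorphic to \<open>Z\<close>. As \<open>T (i p)\<close> fixes \<open>Z\<close>,
  it is a split monomorphism on that summand.
\<close>

lemma retract_transpose_split_mono:
  assumes W: "local_obj H W"
    and i: "i \<in> Hom G X (ob S W)" and p: "p \<in> Hom G (ob S W) X" and pi: "p \<cdot>\<^bsub>G\<^esub> i = Idt G X"
    and X: "Idt G X \<noteq> HZero G X X"
  shows "split_mono H W (ob T (ob S W)) (\<phi> W (ob S W) (i \<cdot>\<^bsub>G\<^esub> p))"
proof -
  let ?P = "ob T (ob S W)"
  have Wo: "W \<in> Obj H" using W by (simp add: local_obj_def)
  note Xo = G.Hom_Dom_Obj[OF i]
  note Ti = T(2)[OF i] and Tp = T(2)[OF p] and e = G.Comp_Hom[OF p i]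
  have "p \<noteq> HZero G (ob S W) X"
    using pi X G.HZero_Comp[OF i Xo] by auto
  then have "Idt H (ob T X) \<noteq> HZero H (ob T X) (ob T X)"
    by (rule T_nonzero[OF Wo p])
  then obtain Z a b where Z: "local_obj H Z" "a \<in> Hom H Z (ob T X)" "b \<in> Hom H (ob T X) Z"
    "b \<cdot>\<^bsub>H\<^esub> a = Idt H Z"
    using H.ex_local_retract[OF T(1)[OF Xo]] by metis
  have Z': "Z \<in> Obj H" "Idt H Z \<noteq> HZero H Z Z" using Z by (auto simp: local_obj_def)
  let ?a = "ar T i \<cdot>\<^bsub>H\<^esub> a" and ?b = "b \<cdot>\<^bsub>H\<^esub> ar T p"
  note a = H.Comp_Hom[OF Z(2) Ti] and b = H.Comp_Hom[OF Tp Z(3)]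
  have TpTi: "ar T p \<cdot>\<^bsub>H\<^esub> ar T i = Idt H (ob T X)"
    using T(4)[OF i p] pi T(3)[OF Xo] by simp
  have "?b \<cdot>\<^bsub>H\<^esub> ?a = b \<cdot>\<^bsub>H\<^esub> ((ar T p \<cdot>\<^bsub>H\<^esub> ar T i) \<cdot>\<^bsub>H\<^esub> a)"
    using Z(2,3) Ti Tp by (simp add: Hom_def)
  then have ba: "?b \<cdot>\<^bsub>H\<^esub> ?a = Idt H Z" using TpTi H.Idt_Comp[OF Z(2)] Z(4) by simp
  have "?b \<cdot>\<^bsub>H\<^esub> ar T (i \<cdot>\<^bsub>G\<^esub> p) = b \<cdot>\<^bsub>H\<^esub> ((ar T p \<cdot>\<^bsub>H\<^esub> ar T i) \<cdot>\<^bsub>H\<^esub> ar T p)"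
    using T(4)[OF p i] Z(3) Ti Tp by (simp add: Hom_def)
  then have bTe: "?b \<cdot>\<^bsub>H\<^esub> ar T (i \<cdot>\<^bsub>G\<^esub> p) = ?b" using TpTi H.Idt_Comp[OF Tp] by simp
  have iso: "is_iso H Z Z (?b \<cdot>\<^bsub>H\<^esub> ?a)"
    unfolding ba using H.Idt_Hom[OF Z'(1)] H.Idt_Comp[OF H.Idt_Hom[OF Z'(1)]] by (auto simp: is_iso_def)
  obtain \<pi> where \<pi>: "\<And>i. i \<in> I \<Longrightarrow> \<pi> i \<in> Hom H ?P (ob (E i) W)"
    "resolution_of_identity H ?P I (\<lambda>i. ob (E i) W) (\<lambda>i. \<iota> i W) \<pi>"
    using TS_resolution[OF W] by metis
  obtain k where k: "k \<in> I" "is_iso H Z Z (?b \<cdot>\<^bsub>H\<^esub> \<iota> k W \<cdot>\<^bsub>H\<^esub> \<pi> k \<cdot>\<^bsub>H\<^esub> ?a)"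
    using H.local_iso_through_resolution[OF \<pi>(2) Z(1) a b iso] by blast
  note \<iota>k = direct_sum_Hom(3)[OF TS_sum[OF Wo] k(1)]
  note \<pi>a = H.Comp_Hom[OF a \<pi>(1)[OF k(1)]] and b\<iota> = H.Comp_Hom[OF \<iota>k b]
  have iso': "is_iso H Z Z ((?b \<cdot>\<^bsub>H\<^esub> \<iota> k W) \<cdot>\<^bsub>H\<^esub> (\<pi> k \<cdot>\<^bsub>H\<^esub> ?a))"
    using k(2) H.Comp_assoc[OF \<pi>a \<iota>k b] by simp
  have "is_iso H Z (ob (E k) W) (\<pi> k \<cdot>\<^bsub>H\<^esub> ?a)"
    using H.split_mono_into_local_is_iso[OF H.split_mono_Comp_left[OF H.is_iso_imp_split_mono[OF iso'] \<pi>a b\<iota>] Z'(2)]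
      E_local[OF k(1) W] by blast
  then have "is_iso H (ob (E k) W) Z (?b \<cdot>\<^bsub>H\<^esub> \<iota> k W)"
    by (rule H.is_iso_cancel_right[OF _ b\<iota> iso'])
  moreover have "?b \<cdot>\<^bsub>H\<^esub> \<iota> k W = ?b \<cdot>\<^bsub>H\<^esub> (ar T (i \<cdot>\<^bsub>G\<^esub> p) \<cdot>\<^bsub>H\<^esub> \<iota> k W)"
    using H.Comp_assoc[OF \<iota>k T(2)[OF e] b] bTe by simp
  ultimately have "split_mono H (ob (E k) W) ?P (ar T (i \<cdot>\<^bsub>G\<^esub> p) \<cdot>\<^bsub>H\<^esub> \<iota> k W)"
    using H.split_mono_Comp_left[OF _ H.Comp_Hom[OF \<iota>k T(2)[OF e]] b] H.is_iso_imp_split_mono by simp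
  then show ?thesis by (rule \<phi>_split_mono[OF Wo e k(1)])
qed

text \<open>
  If \<open>S W\<close> is the biproduct of two nonzero objects with idempotents \<open>e\<close> and \<open>f\<close>, then \<open>\<phi> e\<close> and
  \<open>\<phi> f\<close> are split monomorphisms from \<open>W\<close>. By the assumption on the \<open>E\<^sub>j W\<close> only the component at \<open>i0\<close> of
  a morphism from \<open>W\<close> to \<open>T S W\<close> can be an isomorphism. Expanding \<open>0 = g \<cdot> T e \<cdot> \<phi> f\<close>, where \<open>g \<cdot> \<phi> e = 1\<close>,
  into its component at \<open>i0\<close> and the rest leads to a contradiction.
\<close>

theorem indecomposable_image:
  assumes W: "local_obj H W" and i0: "i0 \<in> I"
    and stab: "\<And>j. j \<in> I \<Longrightarrow> isomorphic_obj H (ob (E j) W) W \<Longrightarrow> j = i0"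
  shows "indecomposable_obj G (ob S W)"
proof -
  let ?SW = "ob S W" and ?P = "ob T (ob S W)"
  have Wo: "W \<in> Obj H" "Idt H W \<noteq> HZero H W W" using W by (auto simp: local_obj_def)
  note SWo = S(1)[OF Wo(1)] and Po = direct_sum_Hom(1)[OF TS_sum[OF Wo(1)]]
  note \<iota> = direct_sum_Hom(3)[OF TS_sum[OF Wo(1)]]
  obtain \<pi> where \<pi>: "\<And>i. i \<in> I \<Longrightarrow> \<pi> i \<in> Hom H ?P (ob (E i) W)"
    "\<And>i. i \<in> I \<Longrightarrow> \<pi> i \<cdot>\<^bsub>H\<^esub> \<iota> i W = Idt H (ob (E i) W)"
    "resolution_of_identity H ?P I (\<lambda>i. ob (E i) W) (\<lambda>i. \<iota> i W) \<pi>"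
    using TS_resolution[OF W] by metis
  have nonzero: "\<not> zero_obj G ?SW"
  proof
    assume "zero_obj G ?SW"
    then have "Idt H ?P = HZero H ?P ?P" by (rule T_zero_obj)
    then have "\<iota> i0 W = HZero H (ob (E i0) W) ?P"
      using H.Idt_Comp[OF \<iota>[OF i0]] H.HZero_Comp[OF \<iota>[OF i0] Po] by simp
    then have "Idt H (ob (E i0) W) = HZero H (ob (E i0) W) (ob (E i0) W)"
      using \<pi>(2)[OF i0] H.Comp_HZero[OF \<pi>(1)[OF i0] direct_sum_Hom(2)[OF TS_sum[OF Wo(1)] i0]] by simp
    then show False using E_local[OF i0 W] by (simp add: local_obj_def)
  qed
  have component: "\<exists>k \<in> I. is_iso H W W ((g \<cdot>\<^bsub>H\<^esub> \<iota> k W) \<cdot>\<^bsub>H\<^esub> (\<pi> k \<cdot>\<^bsub>H\<^esub> f)) \<and>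
      is_iso H W (ob (E k) W) (\<pi> k \<cdot>\<^bsub>H\<^esub> f) \<and> k = i0"
    if f: "f \<in> Hom H W ?P" and g: "g \<in> Hom H ?P W" and iso: "is_iso H W W (g \<cdot>\<^bsub>H\<^esub> f)" for f g
  proof -
    obtain k where k: "k \<in> I" "is_iso H W W (g \<cdot>\<^bsub>H\<^esub> \<iota> k W \<cdot>\<^bsub>H\<^esub> \<pi> k \<cdot>\<^bsub>H\<^esub> f)"
      using H.local_iso_through_resolution[OF \<pi>(3) W f g iso] by blast
    note \<pi>f = H.Comp_Hom[OF f \<pi>(1)[OF k(1)]] and g\<iota> = H.Comp_Hom[OF \<iota>[OF k(1)] g]
    have iso': "is_iso H W W ((g \<cdot>\<^bsub>H\<^esub> \<iota> k W) \<cdot>\<^bsub>H\<^esub> (\<pi> k \<cdot>\<^bsub>H\<^esub> f))"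
      using k(2) H.Comp_assoc[OF \<pi>f \<iota>[OF k(1)] g] by simp
    have "is_iso H W (ob (E k) W) (\<pi> k \<cdot>\<^bsub>H\<^esub> f)"
      using H.split_mono_into_local_is_iso[OF H.split_mono_Comp_left[OF H.is_iso_imp_split_mono[OF iso'] \<pi>f g\<iota>] Wo(2)]
        E_local[OF k(1) W] by blast
    moreover from this have "k = i0"
      using stab[OF k(1)] H.is_isoE unfolding isomorphic_obj_def by metis
    ultimately show ?thesis using k(1) iso' by blast
  qed
  have "zero_obj G X \<or> zero_obj G Y" if bp: "biproduct G X Y ?SW i1 i2 p1 p2" for X Y i1 i2 p1 p2
  proof (rule ccontr)
    note B = bp[unfolded biproduct_def]
    assume "\<not> (zero_obj G X \<or> zero_obj G Y)"
    then have XY: "Idt G X \<noteq> HZero G X X" "Idt G Y \<noteq> HZero G Y Y"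
      using B by (auto simp: G.zero_obj_iff)
    let ?e = "i1 \<cdot>\<^bsub>G\<^esub> p1" and ?f = "i2 \<cdot>\<^bsub>G\<^esub> p2"
    let ?e' = "\<phi> W ?SW ?e" and ?f' = "\<phi> W ?SW ?f" and ?\<eta> = "\<phi> W ?SW (Idt G ?SW)"
    have e: "?e \<in> Hom G ?SW ?SW" and f: "?f \<in> Hom G ?SW ?SW" using B G.Comp_Hom by blast+
    note Te = T(2)[OF e] and \<eta> = \<phi>_Hom[OF Wo(1) G.Idt_Hom[OF SWo]]
    note e' = \<phi>_Hom[OF Wo(1) e] and f' = \<phi>_Hom[OF Wo(1) f]
    have "split_mono H W ?P ?e'" "split_mono H W ?P ?f'"
      using retract_transpose_split_mono[OF W] B XY by auto
    then obtain g g' where g: "g \<in> Hom H ?P W" "g \<cdot>\<^bsub>H\<^esub> ?e' = Idt H W"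
      and g': "g' \<in> Hom H ?P W" "g' \<cdot>\<^bsub>H\<^esub> ?f' = Idt H W"
      unfolding split_mono_def by blast
    have idW: "is_iso H W W (Idt H W)"
      using H.Idt_Hom[OF Wo(1)] H.Idt_Comp[OF H.Idt_Hom[OF Wo(1)]] by (auto simp: is_iso_def)
    let ?g = "g \<cdot>\<^bsub>H\<^esub> ar T ?e"
    note gT = H.Comp_Hom[OF Te g(1)]
    have "?e' = ar T ?e \<cdot>\<^bsub>H\<^esub> ?\<eta>"
      using \<phi>_Comp[OF Wo(1) G.Idt_Hom[OF SWo] e] G.Comp_Idt[OF e] by simp
    then have "?g \<cdot>\<^bsub>H\<^esub> ?\<eta> = Idt H W" using H.Comp_assoc[OF \<eta> Te g(1)] g(2) by simp
    then have g\<eta>: "is_iso H W W ((?g \<cdot>\<^bsub>H\<^esub> \<iota> i0 W) \<cdot>\<^bsub>H\<^esub> (\<pi> i0 \<cdot>\<^bsub>H\<^esub> ?\<eta>))"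
      "is_iso H W (ob (E i0) W) (\<pi> i0 \<cdot>\<^bsub>H\<^esub> ?\<eta>)"
      using component[OF \<eta> gT] idW by auto
    note g\<iota> = H.Comp_Hom[OF \<iota>[OF i0] gT]
    \<comment> \<open>The morphism \<open>g \<cdot> T e\<close> is invertible on the summand at \<open>i0\<close>; this is independent of what it is
      composed with, so the unit \<open>\<eta>\<close> can be exchanged for \<open>\<phi> f\<close>.\<close>
    have g\<iota>_iso: "is_iso H (ob (E i0) W) W (?g \<cdot>\<^bsub>H\<^esub> \<iota> i0 W)"
      by (rule H.is_iso_cancel_right[OF g\<eta>(2) g\<iota> g\<eta>(1)])
    have \<pi>f_iso: "is_iso H W (ob (E i0) W) (\<pi> i0 \<cdot>\<^bsub>H\<^esub> ?f')"
      using component[OF f' g'(1)] g'(2) idW by auto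
    have u: "is_iso H W W ((?g \<cdot>\<^bsub>H\<^esub> \<iota> i0 W) \<cdot>\<^bsub>H\<^esub> (\<pi> i0 \<cdot>\<^bsub>H\<^esub> ?f'))"
      by (rule H.is_iso_Comp[OF \<pi>f_iso g\<iota>_iso])
    have ef: "?e \<cdot>\<^bsub>G\<^esub> ?f = HZero G ?SW ?SW"
    proof -
      have ip: "i1 \<in> Hom G X ?SW" "p1 \<in> Hom G ?SW X" "i2 \<in> Hom G Y ?SW" "p2 \<in> Hom G ?SW Y"
        using B by auto
      have "?e \<cdot>\<^bsub>G\<^esub> ?f = i1 \<cdot>\<^bsub>G\<^esub> ((p1 \<cdot>\<^bsub>G\<^esub> i2) \<cdot>\<^bsub>G\<^esub> p2)" using ip by (simp add: Hom_def)
      then show ?thesis using B G.HZero_Comp[of p2 ?SW Y X] G.Comp_HZero[of i1 X ?SW ?SW] SWo by simp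
    qed
    have "ar T ?e \<cdot>\<^bsub>H\<^esub> ?f' = HZero H W ?P"
      using \<phi>_Comp[OF Wo(1) f e] ef \<phi>_HZero[OF Wo(1) SWo] by simp
    then have gf0: "?g \<cdot>\<^bsub>H\<^esub> ?f' = HZero H W W"
      using H.Comp_assoc[OF f' Te g(1)] H.Comp_HZero[OF g(1) Wo(1)] by simp
    obtain q where q: "q \<in> Hom H ?P ?P" "HAdd H (\<iota> i0 W \<cdot>\<^bsub>H\<^esub> \<pi> i0) q = Idt H ?P"
      "q \<cdot>\<^bsub>H\<^esub> \<iota> i0 W = HZero H (ob (E i0) W) ?P"
      using H.complement_of_retract[OF \<iota>[OF i0] \<pi>(1)[OF i0] \<pi>(2)[OF i0]] by metis
    let ?u = "(?g \<cdot>\<^bsub>H\<^esub> \<iota> i0 W) \<cdot>\<^bsub>H\<^esub> (\<pi> i0 \<cdot>\<^bsub>H\<^esub> ?f')" and ?v = "(?g \<cdot>\<^bsub>H\<^esub> q) \<cdot>\<^bsub>H\<^esub> ?f'"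
    note gq = H.Comp_Hom[OF q(1) gT]
    have uH: "?u \<in> Hom H W W" and vH: "?v \<in> Hom H W W"
      using H.is_iso_Hom[OF u] H.Comp_Hom[OF f' gq] by auto
    have "?g \<cdot>\<^bsub>H\<^esub> HAdd H (\<iota> i0 W \<cdot>\<^bsub>H\<^esub> \<pi> i0) q \<cdot>\<^bsub>H\<^esub> ?f' = HAdd H ?u ?v"
      using gT \<iota>[OF i0] \<pi>(1)[OF i0] q(1) f' g(1) Te by (simp add: Hom_def)
    then have uv: "HAdd H ?u ?v = HZero H W W" using q(2) H.Idt_Comp[OF f'] gf0 by simp
    \<comment> \<open>As the negative of an isomorphism, \<open>v\<close> has an invertible component. It would have to be the one
      at \<open>i0\<close>, which \<open>q\<close> removes.\<close>
    have "is_iso H W W ?v" by (rule H.is_iso_negative[OF u vH uv])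
    then have "is_iso H W W (((?g \<cdot>\<^bsub>H\<^esub> q) \<cdot>\<^bsub>H\<^esub> \<iota> i0 W) \<cdot>\<^bsub>H\<^esub> (\<pi> i0 \<cdot>\<^bsub>H\<^esub> ?f'))"
      using component[OF f' gq] by blast
    moreover have "(?g \<cdot>\<^bsub>H\<^esub> q) \<cdot>\<^bsub>H\<^esub> \<iota> i0 W = HZero H (ob (E i0) W) W"
      using H.Comp_assoc[OF \<iota>[OF i0] q(1) gT] q(3) H.Comp_HZero[OF gT H.Hom_Dom_Obj[OF \<iota>[OF i0]]] by simp
    ultimately show False
      using H.HZero_Comp[OF H.is_iso_Hom[OF \<pi>f_iso] Wo(1)] H.HZero_not_iso[OF Wo(2)] by simp
  qed
  then show ?thesis using SWo nonzero unfolding indecomposable_obj_def by blast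
qed

end

section \<open>Normal subgroup situations\<close>

theorem theorem4p8:
  fixes H :: "('o1, 'm1) preadd_cat" and G :: "('o2, 'm2) preadd_cat"
    and S :: "('o1, 'm1, 'o2, 'm2) fctr" and T :: "('o2, 'm2, 'o1, 'm1) fctr"
    and I :: "'i set" and E :: "'i \<Rightarrow> ('o1, 'm1, 'o1, 'm1) fctr" and i0 :: 'i and W :: 'o1
  assumes "additive_krull_schmidt_category H" and "additive_krull_schmidt_category G"
    and "normal_subgroup_situation H G S T I E"
    and "i0 \<in> I" and "nat_isomorphic H H (E i0) id_functor"
    and "\<forall>i \<in> I. \<exists>E_hat. self_equivalence G E_hat \<and>
      nat_isomorphic H G (S \<circ>\<^sub>F E i) (E_hat \<circ>\<^sub>F S) \<and>
      nat_isomorphic G H (T \<circ>\<^sub>F E_hat) (E i \<circ>\<^sub>F T)"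
    and "indecomposable_obj H W"
    and "\<forall>j \<in> I. isomorphic_obj H (ob (E j) W) W \<longleftrightarrow> j = i0"
  shows "indecomposable_obj G (ob S W)"
proof -
  interpret H: additive_krull_schmidt_category H by fact
  interpret G: additive_krull_schmidt_category G by fact
  have adj: "adjoint_pair H G S T" and equiv: "\<forall>i \<in> I. self_equivalence H (E i)"
    and sum: "functor_direct_sum H H I E (T \<circ>\<^sub>F S)"
    using assms(3) by (simp_all add: normal_subgroup_situation_def)
  from adj obtain \<phi> where functors: "is_functor H G S" "is_functor G H T"
    and bij: "\<forall>x \<in> Obj H. \<forall>y \<in> Obj G. bij_betw (\<phi> x y) (Hom G (ob S x) y) (Hom H x (ob T y))"
    and nat: "\<forall>x \<in> Obj H. \<forall>x' \<in> Obj H. \<forall>y \<in> Obj G. \<forall>y' \<in> Obj G.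
        \<forall>f \<in> Hom H x' x. \<forall>g \<in> Hom G y y'. \<forall>h \<in> Hom G (ob S x) y.
          \<phi> x' y' (g \<cdot>\<^bsub>G\<^esub> h \<cdot>\<^bsub>G\<^esub> ar S f) = ar T g \<cdot>\<^bsub>H\<^esub> \<phi> x y h \<cdot>\<^bsub>H\<^esub> f"
    unfolding adjoint_pair_def by blast
  from sum obtain \<iota> where \<iota>: "\<forall>i \<in> I. nat_trans H H (E i) (T \<circ>\<^sub>F S) (\<iota> i)"
    "\<forall>x \<in> Obj H. direct_sum H I (\<lambda>i. ob (E i) x) (ob (T \<circ>\<^sub>F S) x) (\<lambda>i. \<iota> i x)"
    unfolding functor_direct_sum_def by blast
  interpret adjunction_with_equivalence_sum H G S T I E \<phi> \<iota>
  proof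
    show "is_functor H G S" "is_functor G H T" by (fact functors)+
    show "bij_betw (\<phi> x y) (Hom G (ob S x) y) (Hom H x (ob T y))"
      if "x \<in> Obj H" "y \<in> Obj G" for x y
      using bij that by simp
    show "\<phi> x' y' (g \<cdot>\<^bsub>G\<^esub> h \<cdot>\<^bsub>G\<^esub> ar S f) = ar T g \<cdot>\<^bsub>H\<^esub> \<phi> x y h \<cdot>\<^bsub>H\<^esub> f"
      if "f \<in> Hom H x' x" "g \<in> Hom G y y'" "h \<in> Hom G (ob S x) y" for f x' x g y y' h
      using nat that H.Hom_Dom_Obj[OF that(1)] H.Hom_Cod_Obj[OF that(1)]
        G.Hom_Dom_Obj[OF that(2)] G.Hom_Cod_Obj[OF that(2)] by simp
    show "self_equivalence H (E i)" "nat_trans H H (E i) (T \<circ>\<^sub>F S) (\<iota> i)" if "i \<in> I" for i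
      using equiv \<iota>(1) that by simp_all
    show "direct_sum H I (\<lambda>i. ob (E i) x) (ob T (ob S x)) (\<lambda>i. \<iota> i x)" if "x \<in> Obj H" for x
      using \<iota>(2) that by (simp add: comp_functor_def)
  qed
  show ?thesis
    using indecomposable_image[OF H.indecomposable_imp_local[OF assms(7)] assms(4)] assms(8) by blast
qed

end
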